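(* Let $m\ge2$ and, for $i\in\{1,2\}$, let $n_i,e_i\ge1$ and $d_i\ge2$. Let $$P_1(X,S)=S^{d_1}+f_{d_1-2}(X)S^{d_1-2}+\cdots+f_1(X)S+f_0(X),\quad P_2(X,S)=S^{d_2}+g_{d_2-2}(X)S^{d_2-2}+\cdots+g_1(X)S+g_0(X)$$ with $f_j,g_j\in k[X]$, and let $R_{n_i,e_i,P_i,m}=k[X,Y,Z]/\langle X^{n_i}Y-P_i(X,Y^m-X^{e_i}Z)\rangle$. Then $R_{n_1,e_1,P_1,m}\simeq R_{n_2,e_2,P_2,m}$ (as $k$-algebras) if and only if $n:=n_1=n_2$, $e:=e_1=e_2$, $d:=d_1=d_2$, and there exist $\lambda,\mu\in k^*$ such that $\frac{\mu^{dm}}{\lambda^{nm}}=\mu$ and $$f_{d-i}(\lambda X)\equiv\mu^ig_{d-i}(X)\bmod X^{n+e}\quad\text{for every } i\in\{2,\ldots,d\}.$$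
   Context: $k$ is a field of characteristic zero; $k^*=k\setminus\{0\}$. *)

theory Defs
  imports
    "HOL-Algebra.Algebraic_Closure_Type"
    "HOL-Algebra.QuotRing"
    "HOL-Number_Theory.Cong"
begin

text \<open>
  The polynomial ring \<open>k[X,Y,Z]\<close> is rendered as the iterated polynomial ring
  \<open>k[X][Y][Z]\<close>, i.e. the type \<open>'a poly poly poly\<close>, where the outermost
  variable is \<open>Z\<close> and the innermost one is \<open>X\<close>.
\<close>

definition emb_X :: "'a::comm_ring_1 poly \<Rightarrow> 'a poly poly poly"
  where "emb_X p = [:[:p:]:]"

definition const3 :: "'a::comm_ring_1 \<Rightarrow> 'a poly poly poly"
  where "const3 c = emb_X [:c:]"

definition var_X :: "'a::comm_ring_1 poly poly poly"
  where "var_X = emb_X [:0, 1:]"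

definition var_Y :: "'a::comm_ring_1 poly poly poly"
  where "var_Y = [:[:0, 1:]:]"

definition var_Z :: "'a::comm_ring_1 poly poly poly"
  where "var_Z = [:0, 1:]"

text \<open>
  \<open>P(X,S)\<close> is an element of \<open>k[X][S]\<close>, i.e. of type \<open>'a poly poly\<close> with outer variable \<open>S\<close>.
  Only the values \<open>f 0, \<dots>, f (d - 2)\<close> are used; there is no term of degree \<open>d - 1\<close>.
\<close>

definition monic_poly :: "nat \<Rightarrow> (nat \<Rightarrow> 'a::comm_ring_1 poly) \<Rightarrow> 'a poly poly"
  where "monic_poly d f = Polynomial.monom 1 d + (\<Sum>j\<le>d - 2. Polynomial.monom (f j) j)"

definition subst_S :: "'a::comm_ring_1 poly poly \<Rightarrow> 'a poly poly poly \<Rightarrow> 'a poly poly poly"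
  where "subst_S P w = poly (map_poly emb_X P) w"

abbreviation ring_kXYZ :: "'a::comm_ring_1 poly poly poly ring"
  where "ring_kXYZ \<equiv> ring_of_type_algebra"

definition R_ideal ::
  "nat \<Rightarrow> nat \<Rightarrow> 'a::comm_ring_1 poly poly \<Rightarrow> nat \<Rightarrow> 'a poly poly poly set"
  where "R_ideal n e P m =
    PIdl\<^bsub>ring_kXYZ\<^esub> (var_X ^ n * var_Y - subst_S P (var_Y ^ m - var_X ^ e * var_Z))"

definition R_ring ::
  "nat \<Rightarrow> nat \<Rightarrow> 'a::comm_ring_1 poly poly \<Rightarrow> nat \<Rightarrow> 'a poly poly poly set ring"
  where "R_ring n e P m = ring_kXYZ Quot (R_ideal n e P m)"

definition R_const ::
  "nat \<Rightarrow> nat \<Rightarrow> 'a::comm_ring_1 poly poly \<Rightarrow> nat \<Rightarrow> 'a \<Rightarrow> 'a poly poly poly set"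
  where "R_const n e P m c = R_ideal n e P m +>\<^bsub>ring_kXYZ\<^esub> const3 c"

text \<open>
  A \<open>k\<close>-algebra is given by a ring \<open>A\<close> together with its structure map \<open>a\<close> from \<open>k\<close> to \<open>A\<close>;
  an isomorphism of \<open>k\<close>-algebras is a ring isomorphism commuting with the structure maps.
\<close>

definition algebra_isomorphic ::
  "('b, 'm) ring_scheme \<Rightarrow> ('k \<Rightarrow> 'b) \<Rightarrow> ('c, 'n) ring_scheme \<Rightarrow> ('k \<Rightarrow> 'c) \<Rightarrow> bool"
  where "algebra_isomorphic A a B b \<longleftrightarrow> (\<exists>h \<in> ring_iso A B. \<forall>c. h (a c) = b c)"

end

theory Submission
  imports Defs "HOL-Computational_Algebra.Formal_Laurent_Series"
begin

text \<open>
Put \<open>S = Y\<^sup>m - X\<^sup>e Z\<close>. Once \<open>x\<close> is invertible, the two relations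
\<open>x\<^sup>n y = P(x, s)\<close> and \<open>x\<^sup>e z = y\<^sup>m - s\<close> express \<open>y\<close> and \<open>z\<close> by \<open>x\<close> and \<open>s\<close>. So the
surface ring is a subring \<open>B\<close> of the Laurent polynomials in \<open>x\<close> with a further variable \<open>s\<close>, and these
are taken inside \<open>k((x))[s]\<close>, where orders and derivatives of coefficients are at hand. Reducing
\<open>s\<^sup>d\<close> and \<open>y\<^sup>m\<close> by the relations gives the normal form behind everything else: \<open>B\<close> is a free
\<open>k[x]\<close>-module on monomials \<open>\<theta>\<^sub>j = s\<^sup>b y\<^sup>c z\<^sup>g\<close> with \<open>b < d\<close> and \<open>c < m\<close>, one for each degree
\<open>j = b + d c + d m g\<close> in \<open>s\<close>, and the leading coefficient of \<open>\<theta>\<^sub>j\<close> is \<open>x\<^sup>-\<^sup>\<rho>\<close> with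
\<open>\<rho>(j) = n c + (n m + e) g\<close>. This shows that the kernel of the evaluation is generated by the defining
relation (\<open>ev_eq_0_iff\<close>) and bounds the poles of leading coefficients (\<open>B_lead\<close>).

The heart of the direction from isomorphisms to congruences is that every isomorphism maps \<open>k[x]\<close> to
\<open>k[x]\<close>. The argument is that of Makar-Limanov. A nonzero locally nilpotent derivation of \<open>B\<close> acts on
leading monomials (ordered by the degree in \<open>s\<close> first) as a monomial derivation, and nilpotency leaves
only \<open>x\<^sup>p d/ds\<close>; hence elements of its kernel have degree 0 in \<open>s\<close>
(\<open>monomial_derivation_weight_zero\<close>, \<open>derivation_kernel_degree_0\<close>). Transporting \<open>x\<^sup>n\<^sup>+\<^sup>e d/ds\<close> along
an isomorphism \<open>h\<close> in both directions yields \<open>h x = c + l x\<close> and \<open>h s = u s + b(x)\<close> with constants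
\<open>l\<close>, \<open>u\<close>. The leading coefficient of \<open>h y\<close> excludes \<open>c \<noteq> 0\<close>, and comparing the poles of \<open>h y\<close>
and \<open>h z\<close> with \<open>\<rho>\<close> identifies \<open>n\<close>, \<open>e\<close> and \<open>d\<close> (\<open>parameters_eq\<close>).

Then \<open>h y = v y + A(x, s)\<close> with \<open>v = u\<^sup>d / l\<^sup>n\<close> and \<open>A\<close> of degree below \<open>d\<close> in \<open>s\<close>. Since
\<open>(h y)\<^sup>m\<close> is \<open>h s\<close> modulo \<open>x\<^sup>e\<close>, the mixed term \<open>y\<^sup>m\<^sup>-\<^sup>1 A\<close> of the binomial expansion has to
vanish modulo \<open>x\<^sup>e\<close>, so \<open>x\<^sup>e\<close> divides \<open>A\<close> (\<open>x_dvd_remainder\<close>), and what remains is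
\<open>v\<^sup>m = u\<close>. Therefore \<open>P\<^sub>1(l x, u s + b)\<close> agrees with \<open>u\<^sup>d P\<^sub>2(x, s)\<close> modulo \<open>x\<^sup>n\<^sup>+\<^sup>e\<close>. As neither
polynomial has a term of degree \<open>d - 1\<close>, \<open>x\<^sup>n\<^sup>+\<^sup>e\<close> divides \<open>b\<close>, and the congruences are read off
from the coefficients.

Conversely, under the conditions on \<open>l\<close> and \<open>u\<close> the rescaling \<open>x \<mapsto> l x\<close>, \<open>s \<mapsto> u s\<close> of \<open>k((x))[s]\<close>
and its inverse map the two surface rings into each other (\<open>rescale_B\<close>).
\<close>

section \<open>Ring homomorphisms and evaluation of polynomials\<close>

locale cring_hom =
  fixes \<phi> :: "'r::comm_ring_1 \<Rightarrow> 's::comm_ring_1"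
  assumes hom_add: "\<phi> (a + b) = \<phi> a + \<phi> b"
    and hom_mult: "\<phi> (a * b) = \<phi> a * \<phi> b"
    and hom_one: "\<phi> 1 = 1"
begin

lemma hom_zero: "\<phi> 0 = 0"
  using hom_add[of 0 0] by simp

lemma hom_uminus: "\<phi> (- a) = - \<phi> a"
  using hom_add[of a "- a"] by (simp add: hom_zero add_eq_0_iff)

lemma hom_diff: "\<phi> (a - b) = \<phi> a - \<phi> b"
  using hom_add[of a "- b"] by (simp add: hom_uminus)

lemma hom_power: "\<phi> (a ^ k) = \<phi> a ^ k"
  by (induction k) (simp_all add: hom_one hom_mult)

lemma hom_sum: "\<phi> (sum F A) = (\<Sum>i\<in>A. \<phi> (F i))"
  by (induction A rule: infinite_finite_induct) (simp_all add: hom_zero hom_add)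

lemma map_poly_hom_pCons: "map_poly \<phi> (pCons a p) = pCons (\<phi> a) (map_poly \<phi> p)"
  by (simp add: map_poly_pCons hom_zero)

lemma map_poly_hom_add: "map_poly \<phi> (p + q) = map_poly \<phi> p + map_poly \<phi> q"
  by (rule poly_eqI) (simp add: coeff_map_poly hom_zero hom_add)

lemma map_poly_hom_smult: "map_poly \<phi> (smult a p) = smult (\<phi> a) (map_poly \<phi> p)"
  by (rule poly_eqI) (simp add: coeff_map_poly hom_zero hom_mult)

lemma map_poly_hom_mult: "map_poly \<phi> (p * q) = map_poly \<phi> p * map_poly \<phi> q"
  by (induction p)
    (simp_all add: map_poly_hom_add map_poly_hom_smult map_poly_hom_pCons hom_zero)

lemma cring_hom_map_poly: "cring_hom (map_poly \<phi>)"
  by unfold_locales (simp_all add: map_poly_hom_add map_poly_hom_mult hom_one)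

lemma cring_hom_eval: "cring_hom (\<lambda>p. poly (map_poly \<phi> p) w)"
  by unfold_locales (simp_all add: map_poly_hom_add map_poly_hom_mult hom_one)

lemma hom_poly: "\<phi> (poly p a) = poly (map_poly \<phi> p) (\<phi> a)"
  by (induction p) (simp_all add: map_poly_hom_pCons hom_add hom_mult hom_zero)

lemma map_poly_hom_pcompose:
  "map_poly \<phi> (pcompose p q) = pcompose (map_poly \<phi> p) (map_poly \<phi> q)"
  by (induction p)
    (simp_all add: pcompose_pCons map_poly_hom_pCons map_poly_hom_add map_poly_hom_mult hom_zero)

end

lemma cring_hom_comp:
  assumes "cring_hom \<phi>" "cring_hom \<psi>"
  shows "cring_hom (\<lambda>x. \<psi> (\<phi> x))"
proof -
  interpret \<phi>: cring_hom \<phi> by fact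
  interpret \<psi>: cring_hom \<psi> by fact
  show ?thesis
    by unfold_locales
      (simp_all add: \<phi>.hom_add \<phi>.hom_mult \<phi>.hom_one \<psi>.hom_add \<psi>.hom_mult \<psi>.hom_one)
qed

lemma cring_hom_emb_X: "cring_hom emb_X"
  by unfold_locales (simp_all add: emb_X_def one_pCons)

interpretation emb_X: cring_hom emb_X
  by (rule cring_hom_emb_X)

lemma cring_hom_subst_S: "cring_hom (\<lambda>Q. subst_S Q w)"
  unfolding subst_S_def by (rule cring_hom.cring_hom_eval[OF cring_hom_emb_X])

section \<open>Polynomials as Laurent series\<close>

definition laurent :: "'a::field_char_0 poly \<Rightarrow> 'a fls"
  where "laurent p = fps_to_fls (fps_of_poly p)"

lemma cring_hom_laurent: "cring_hom laurent"
  by unfold_locales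
    (simp_all add: laurent_def fps_of_poly_add fps_of_poly_mult fls_times_fps_to_fls)

interpretation laurent: cring_hom laurent
  by (rule cring_hom_laurent)

lemma laurent_nth: "fls_nth (laurent p) k = (if k < 0 then 0 else coeff p (nat k))"
  by (simp add: laurent_def)

lemma laurent_eq_iff: "laurent p = laurent q \<longleftrightarrow> p = q"
  by (simp add: laurent_def fps_of_poly_eq_iff)

lemma laurent_eq_0_iff: "laurent p = 0 \<longleftrightarrow> p = 0"
  using laurent_eq_iff[of p 0] by (simp add: laurent.hom_zero)

lemma laurent_const: "laurent [:c:] = fls_const c"
  by (simp add: laurent_def fps_of_poly_const)

lemma laurent_X: "laurent [:0, 1:] = fls_X"
  by (simp add: laurent_def)

lemma laurent_subdegree_nonneg: "fls_subdegree (laurent p) \<ge> 0"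
  by (simp add: laurent_def fls_subdegree_fls_to_fps)

lemma cring_hom_const_poly: "cring_hom (\<lambda>c. [:c:])"
  by unfold_locales simp_all

lemma cring_hom_laurent_const: "cring_hom (\<lambda>p. [:laurent p:])"
  by (rule cring_hom_comp[OF cring_hom_laurent cring_hom_const_poly])

lemma const_power: "[:c:] ^ k = [:c ^ k :: 'b::comm_ring_1:]"
  by (induction k) simp_all

lemma laurent_pCons: "laurent (pCons c p) = fls_const c + fls_X * laurent p"
proof -
  have "pCons c p = [:c:] + [:0, 1:] * p" by simp
  then show ?thesis
    by (simp only: laurent.hom_add laurent.hom_mult laurent_const laurent_X)
qed

lemma laurent_linear: "laurent [:0, l:] = fls_const l * fls_X"
  by (simp add: laurent_pCons laurent_const laurent.hom_zero mult.commute)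

lemma map_poly_laurent_const: "map_poly laurent [:p:] = [:laurent p:]"
  by (simp add: map_poly_pCons laurent.hom_zero)

lemma map_laurent_eq_iff: "map_poly laurent p = map_poly laurent q \<longleftrightarrow> p = q"
  by (auto simp: poly_eq_iff coeff_map_poly laurent.hom_zero laurent_eq_iff)

lemma poly_map_const: "poly (map_poly (\<lambda>p. [:laurent p:]) Q) [:0, 1:] = map_poly laurent Q"
  by (induction Q) (simp_all add: map_poly_pCons laurent.hom_zero)

section \<open>The surface ring inside \<open>k((x))[s]\<close>\<close>

text \<open>
The field \<open>k\<close> is the type \<open>'a\<close>; \<open>'a fls poly\<close> is \<open>k((x))[s]\<close>, so that \<open>degree\<close> and \<open>pderiv\<close>
refer to \<open>s\<close> and \<open>fls_subdegree\<close> is the order in \<open>x\<close>.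
\<close>

locale danielewski =
  fixes n e m d :: nat and f :: "nat \<Rightarrow> 'a::field_char_0 poly"
  assumes n_pos: "n \<ge> 1" and e_pos: "e \<ge> 1" and m_ge_2: "m \<ge> 2" and d_ge_2: "d \<ge> 2"
begin

abbreviation P :: "'a poly poly" where "P \<equiv> monic_poly d f"

abbreviation s :: "'a fls poly" where "s \<equiv> [:0, 1:]"

definition Ps :: "'a fls poly" where "Ps = map_poly laurent P"

definition y :: "'a fls poly" where "y = smult (inverse (fls_X ^ n)) Ps"

definition z :: "'a fls poly" where "z = smult (inverse (fls_X ^ e)) (y ^ m - s)"

definition ev2 :: "'a poly poly \<Rightarrow> 'a fls poly"
  where "ev2 G = poly (map_poly (\<lambda>p. [:laurent p:]) G) y"

definition ev :: "'a poly poly poly \<Rightarrow> 'a fls poly"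
  where "ev F = poly (map_poly ev2 F) z"

definition B :: "'a fls poly set" where "B = range ev"

definition varS :: "'a poly poly poly" where "varS = var_Y ^ m - var_X ^ e * var_Z"

definition rel :: "'a poly poly poly" where "rel = var_X ^ n * var_Y - subst_S P varS"

lemma ev2_hom: "cring_hom ev2"
  unfolding ev2_def by (rule cring_hom.cring_hom_eval[OF cring_hom_laurent_const])

sublocale ev: cring_hom ev
  unfolding ev_def by (rule cring_hom.cring_hom_eval[OF ev2_hom])

lemma ev2_const: "ev2 [:p:] = [:laurent p:]"
  by (simp add: ev2_def map_poly_pCons laurent.hom_zero)

lemma ev_emb_X: "ev (emb_X p) = [:laurent p:]"
  by (simp add: ev_def emb_X_def map_poly_pCons cring_hom.hom_zero[OF ev2_hom] ev2_const)

lemma ev_const3: "ev (const3 c) = [:fls_const c:]"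
  by (simp add: const3_def ev_emb_X laurent_const)

lemma ev_var_X: "ev var_X = [:fls_X:]"
  by (simp add: var_X_def ev_emb_X laurent_X)

lemma ev_var_Y: "ev var_Y = y"
  by (simp add: ev_def var_Y_def map_poly_pCons cring_hom.hom_zero[OF ev2_hom])
    (simp add: ev2_def map_poly_pCons laurent.hom_zero laurent.hom_one)

lemma ev_var_Z: "ev var_Z = z"
  by (simp add: ev_def var_Z_def map_poly_pCons cring_hom.hom_zero[OF ev2_hom]
      cring_hom.hom_one[OF ev2_hom])

lemma x_power_y: "[:fls_X:] ^ n * y = Ps"
  by (simp add: y_def const_power)

lemma x_power_z: "[:fls_X:] ^ e * z = y ^ m - s"
  by (simp add: z_def const_power)

lemma ev_varS: "ev varS = s"
proof -
  have "ev varS = y ^ m - [:fls_X:] ^ e * z"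
    by (simp only: varS_def ev.hom_diff ev.hom_mult ev.hom_power ev_var_X ev_var_Y ev_var_Z)
  then show ?thesis
    by (simp only: x_power_z) simp
qed

lemma ev_subst_S: "ev (subst_S Q w) = poly (map_poly (\<lambda>p. [:laurent p:]) Q) (ev w)"
  by (simp add: subst_S_def ev.hom_poly map_poly_map_poly o_def ev.hom_zero ev_emb_X
      emb_X.hom_zero)

lemma ev_rel: "ev rel = 0"
proof -
  have "ev rel = [:fls_X:] ^ n * y - Ps"
    by (simp only: rel_def ev.hom_diff ev.hom_mult ev.hom_power ev_var_X ev_var_Y ev_subst_S
        ev_varS poly_map_const Ps_def)
  then show ?thesis by (simp only: x_power_y diff_self)
qed

end

section \<open>Normal forms modulo the defining relation\<close>

lemma emb_X_power: "var_X ^ k = emb_X ([:0, 1:] ^ k)"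
  by (simp add: var_X_def emb_X.hom_power)

lemma poly_XYZ_induct [case_names const add Y Z]:
  assumes c: "\<And>p. Q (emb_X p)"
    and a: "\<And>F G. Q F \<Longrightarrow> Q G \<Longrightarrow> Q (F + G)"
    and vY: "\<And>F. Q F \<Longrightarrow> Q (var_Y * F)"
    and vZ: "\<And>F. Q F \<Longrightarrow> Q (var_Z * F)"
  shows "Q F"
proof (induction F)
  case 0
  show ?case using c[of 0] by (simp add: emb_X.hom_zero)
next
  case (pCons G F)
  have "Q [:G:]"
  proof (induction G)
    case 0
    show ?case using c[of 0] by (simp add: emb_X.hom_zero)
  next
    case (pCons p G)
    have "[:pCons p G:] = emb_X p + var_Y * [:G:]"
      by (simp add: emb_X_def var_Y_def)
    then show ?case using a[OF c vY[OF pCons.IH]] by simp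
  qed
  moreover have "pCons G F = [:G:] + var_Z * F"
    by (simp add: var_Z_def)
  ultimately show ?case using a vZ[OF pCons.IH] by simp
qed

lemma coeff_monic_poly:
  "d \<ge> 2 \<Longrightarrow> coeff (monic_poly d f) i = (if i = d then 1 else if i \<le> d - 2 then f i else 0)"
  by (auto simp: monic_poly_def coeff_sum)

lemma degree_lead_diff:
  fixes p q :: "'b::ab_group_add poly"
  assumes "degree q < degree p"
  shows "degree (p - q) = degree p" "lead_coeff (p - q) = lead_coeff p"
proof -
  show "degree (p - q) = degree p"
    using degree_add_eq_left[of "- q" p] assms by simp
  then show "lead_coeff (p - q) = lead_coeff p"
    using assms by (simp add: coeff_eq_0)
qed

context danielewski
begin

text \<open>
The exponents of the basis monomial of degree \<open>j\<close> are the digits of \<open>j\<close> in the mixed radix system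
with place values \<open>1\<close>, \<open>d\<close>, \<open>d m\<close>; these are the degrees in \<open>s\<close> of \<open>s\<close>, \<open>y\<close> and \<open>z\<close>.
The number \<open>rho j\<close> is the order of the pole at \<open>x = 0\<close> of its leading coefficient.
\<close>

definition monomial_SYZ :: "nat \<Rightarrow> nat \<Rightarrow> nat \<Rightarrow> 'a poly poly poly"
  where "monomial_SYZ b c g = varS ^ b * var_Y ^ c * var_Z ^ g"

definition Theta :: "nat \<Rightarrow> 'a poly poly poly"
  where "Theta j = monomial_SYZ (j mod d) ((j div d) mod m) (j div (d * m))"

definition rho :: "nat \<Rightarrow> nat"
  where "rho j = n * ((j div d) mod m) + (n * m + e) * (j div (d * m))"

text \<open>
Polynomials that are congruent, modulo the defining relation, to a combination of basis monomials.
\<close>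

inductive_set NF :: "'a poly poly poly set" where
  NF_rel: "rel * q \<in> NF"
| NF_step: "F \<in> NF \<Longrightarrow> F + emb_X p * Theta j \<in> NF"

lemma NF_add: 
  assumes "F \<in> NF" "G \<in> NF" shows "F + G \<in> NF"
proof -
  have 1: "F + rel * q \<in> NF" for q
    using assms(1)
  proof induction
    case (NF_rel q')
    show ?case using NF.NF_rel[of "q' + q"] by (simp add: distrib_left)
  next
    case (NF_step F p j)
    show ?case using NF.NF_step[OF NF_step.IH, of p j] by (simp add: algebra_simps)
  qed
  show ?thesis using assms(2)
  proof induction
    case (NF_rel q')
    show ?case by (rule 1)
  next
    case (NF_step F p j)
    show ?case using NF.NF_step[OF NF_step.IH, of p j] by (simp add: algebra_simps)
  qed
qed

lemma NF_zero: "0 \<in> NF"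
  using NF_rel[of 0] by simp

lemma NF_sum: "(\<And>i. i \<in> A \<Longrightarrow> F i \<in> NF) \<Longrightarrow> sum F A \<in> NF"
  by (induction A rule: infinite_finite_induct) (simp_all add: NF_zero NF_add)

lemma NF_Theta: "emb_X p * Theta j \<in> NF"
  using NF_step[OF NF_zero, of p j] by simp

lemma subst_S_monic:
  "subst_S P w = w ^ d + (\<Sum>j\<le>d - 2. emb_X (f j) * w ^ j)"
proof -
  interpret sb: cring_hom "\<lambda>Q. subst_S Q w" by (rule cring_hom_subst_S)
  have "subst_S (Polynomial.monom c j) w = emb_X c * w ^ j" for c j
    by (simp add: subst_S_def map_poly_monom emb_X.hom_zero poly_monom)
  then show ?thesis
    by (simp add: monic_poly_def sb.hom_add sb.hom_sum emb_X.hom_one)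
qed

text \<open>
The relation replaces \<open>S\<^sup>d\<close> by \<open>X\<^sup>n Y\<close> and terms of lower degree, and \<open>Y\<^sup>m\<close> equals \<open>S + X\<^sup>e Z\<close>.
The first rewriting keeps the weight \<open>b + d c + d m g\<close> and lowers the exponent of \<open>S\<close>; the second keeps
the weight and that exponent and lowers the exponent of \<open>Y\<close>. All other terms have smaller weight.
\<close>

lemma NF_monomial_SYZ: "emb_X p * monomial_SYZ b c g \<in> NF"
proof (induction "(b, c, g)" arbitrary: p b c g
    rule: wf_induct_rule[OF wf_measures[of "[\<lambda>(b, c, g). b + d * c + d * m * g, \<lambda>(b, c, g). b, \<lambda>(b, c, g). c]"]])
  case 1
  note IH = 1(1)
  consider "b \<ge> d" | "b < d" "c \<ge> m" | "b < d" "c < m" by linarith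
  then show ?case
  proof cases
    case 1
    then obtain b' where b: "b = b' + d" by (metis add.commute le_Suc_ex)
    have S: "varS ^ d = emb_X ([:0, 1:] ^ n) * var_Y - (\<Sum>j\<le>d - 2. emb_X (f j) * varS ^ j) - rel"
      by (simp add: rel_def subst_S_monic emb_X_power)
    have "emb_X p * monomial_SYZ b c g =
        (emb_X p * (varS ^ b' * var_Y ^ c * var_Z ^ g)) * varS ^ d"
      by (simp add: monomial_SYZ_def b power_add)
    also have "\<dots> = emb_X (p * [:0, 1:] ^ n) * monomial_SYZ b' (Suc c) g
        + (\<Sum>j\<le>d - 2. emb_X (- (p * f j)) * monomial_SYZ (b' + j) c g)
        + rel * (emb_X (- p) * monomial_SYZ b' c g)"
      unfolding S monomial_SYZ_def emb_X.hom_mult emb_X.hom_uminus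
      by (simp add: algebra_simps sum_distrib_left sum_negf power_add)
    also have "\<dots> \<in> NF"
    proof (intro NF_add NF_sum NF_rel IH)
      fix j assume "j \<in> {..d - 2}"
      then show "((b' + j, c, g), (b, c, g)) \<in> measures [\<lambda>(b, c, g). b + d * c + d * m * g, \<lambda>(b, c, g). b, \<lambda>(b, c, g). c]"
        using b d_ge_2 by auto
    qed (use b d_ge_2 in auto)
    finally show ?thesis .
  next
    case 2
    then obtain c' where c: "c = c' + m" by (metis add.commute le_Suc_ex)
    have Y: "var_Y ^ m = varS + emb_X ([:0, 1:] ^ e) * var_Z"
      by (simp add: varS_def emb_X_power)
    have "emb_X p * monomial_SYZ b c g = (emb_X p * (varS ^ b * var_Y ^ c' * var_Z ^ g)) * var_Y ^ m"
      by (simp add: monomial_SYZ_def c power_add)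
    also have "\<dots> = emb_X p * monomial_SYZ (Suc b) c' g + emb_X (p * [:0, 1:] ^ e) * monomial_SYZ b c' (Suc g)"
      unfolding Y monomial_SYZ_def emb_X.hom_mult by (simp add: algebra_simps)
    also have "\<dots> \<in> NF"
    proof (intro NF_add IH)
      have "1 < d * m"
        using d_ge_2 m_ge_2 by (metis One_nat_def Suc_1 Suc_le_lessD less_1_mult)
      then show "((Suc b, c', g), (b, c, g)) \<in> measures [\<lambda>(b, c, g). b + d * c + d * m * g, \<lambda>(b, c, g). b, \<lambda>(b, c, g). c]"
        by (auto simp: c algebra_simps)
    qed (use m_ge_2 in \<open>auto simp: c algebra_simps\<close>)
    finally show ?thesis .
  next
    case 3
    define j where "j = b + d * (c + m * g)"
    have 0: "j mod d = b" "j div d = c + m * g"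
      using 3 by (simp_all add: j_def)
    have "(j div d) mod m = c" "j div (d * m) = g"
      using 3 by (simp_all add: div_mult2_eq 0)
    then have "monomial_SYZ b c g = Theta j"
      by (simp add: Theta_def 0)
    then show ?thesis by (simp add: NF_Theta)
  qed
qed

lemma NF_all: "F \<in> NF"
proof -
  have "emb_X p * monomial_SYZ b c g * F \<in> NF" for p b c g
  proof (induction F arbitrary: p b c g rule: poly_XYZ_induct)
    case (const q)
    show ?case using NF_monomial_SYZ[of "p * q" b c g] by (simp add: emb_X.hom_mult ac_simps)
  next
    case (add F G)
    then show ?case by (simp add: distrib_left NF_add)
  next
    case (Y F)
    show ?case using Y[of p b "Suc c" g] by (simp add: monomial_SYZ_def ac_simps)
  next
    case (Z F)
    show ?case using Z[of p b c "Suc g"] by (simp add: monomial_SYZ_def ac_simps)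
  qed
  from this[of 1 0 0 0] show ?thesis by (simp add: monomial_SYZ_def emb_X.hom_one)
qed

text \<open>
The identity is claimed for every large \<open>J'\<close>, so that the index of a further basis monomial can be
assumed to lie in the range of summation.
\<close>

lemma NF_expand: "\<exists>q a J. \<forall>J'\<ge>J. F = rel * q + (\<Sum>j<J'. emb_X (a j) * Theta j)"
  using NF_all[of F]
proof induction
  case (NF_rel q)
  show ?case by (intro exI[of _ q] exI[of _ "\<lambda>_. 0"] exI[of _ 0]) (simp add: emb_X.hom_zero)
next
  case (NF_step F p i)
  then obtain q a J where *: "\<And>J'. J' \<ge> J \<Longrightarrow> F = rel * q + (\<Sum>j<J'. emb_X (a j) * Theta j)"
    by blast
  define a' where "a' = a(i := a i + p)"
  have "F + emb_X p * Theta i = rel * q + (\<Sum>j<J'. emb_X (a' j) * Theta j)"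
    if "J' \<ge> max J (Suc i)" for J'
  proof -
    have "emb_X (a' j) * Theta j = emb_X (a j) * Theta j + (if j = i then emb_X p * Theta j else 0)" for j
      by (simp add: a'_def emb_X.hom_add distrib_right)
    then have "(\<Sum>j<J'. emb_X (a' j) * Theta j) = (\<Sum>j<J'. emb_X (a j) * Theta j) + emb_X p * Theta i"
      using that by (simp add: sum.distrib sum.delta)
    then show ?thesis using *[of J'] that by simp
  qed
  then show ?case by blast
qed

section \<open>Leading coefficients in the surface ring\<close>

definition theta :: "nat \<Rightarrow> 'a fls poly"
  where "theta j = s ^ (j mod d) * y ^ ((j div d) mod m) * z ^ (j div (d * m))"

lemma ev_Theta: "ev (Theta j) = theta j"
  by (simp only: Theta_def monomial_SYZ_def theta_def ev.hom_mult ev.hom_power ev_varS ev_var_Y ev_var_Z)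

lemma coeff_Ps: "coeff Ps i = laurent (coeff P i)"
  by (simp add: Ps_def coeff_map_poly laurent.hom_zero)

lemma degree_Ps: "degree Ps = d"
  by (rule antisym[OF degree_le le_degree])
    (auto simp: coeff_Ps coeff_monic_poly d_ge_2 laurent.hom_zero laurent.hom_one)

lemma lead_Ps: "lead_coeff Ps = 1"
  by (simp add: degree_Ps coeff_Ps coeff_monic_poly d_ge_2 laurent.hom_one)

lemma degree_y: "degree y = d"
  by (simp add: y_def degree_Ps)

lemma lead_y: "lead_coeff y = inverse fls_X ^ n"
  using lead_Ps by (simp add: y_def degree_Ps power_inverse)

lemma y_nz: "y \<noteq> 0"
  using degree_y d_ge_2 by auto

lemma dm_gt: "1 < d * m"
  using d_ge_2 m_ge_2 by (metis One_nat_def Suc_1 Suc_le_lessD less_1_mult)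

lemma degree_z: "degree z = d * m" and lead_z: "lead_coeff z = inverse fls_X ^ (n * m + e)"
proof -
  have 1: "degree (y ^ m) = d * m" "lead_coeff (y ^ m) = inverse fls_X ^ (n * m)"
    using y_nz by (simp add: degree_power_eq degree_y, simp only: lead_coeff_power lead_y power_mult)
  have d1: "degree s < degree (y ^ m)"
    using dm_gt by (simp add: 1)
  have 2: "degree (y ^ m - s) = d * m" "lead_coeff (y ^ m - s) = inverse fls_X ^ (n * m)"
    using degree_lead_diff[OF d1] 1 by simp_all
  show "degree z = d * m" by (simp add: z_def 2(1))
  show "lead_coeff z = inverse fls_X ^ (n * m + e)" 
    using 2 by (simp add: z_def power_inverse power_add)
qed

lemma z_nz: "z \<noteq> 0"
  using degree_z dm_gt by auto

lemma degree_theta: "degree (theta j) = j"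
proof -
  have "degree (theta j) = j mod d + d * ((j div d) mod m) + d * m * (j div (d * m))"
    using y_nz z_nz
    by (simp add: theta_def degree_mult_eq degree_power_eq degree_y degree_z)
  also have "\<dots> = j mod d + d * ((j div d) mod m + m * (j div d div m))"
    by (simp only: div_mult2_eq distrib_left mult.assoc add.assoc)
  also have "\<dots> = j" by (simp only: mod_mult_div_eq)
  finally show ?thesis .
qed

lemma lead_theta: "lead_coeff (theta j) = inverse fls_X ^ rho j"
  by (simp only: theta_def rho_def lead_coeff_mult lead_coeff_power lead_y lead_z power_add power_mult)
    simp

text \<open>
The basis elements have pairwise different degrees in \<open>s\<close>, so the summand with the largest index and a
nonzero coefficient cannot be cancelled. This is linear independence over \<open>k[x]\<close>.
\<close>

lemma degree_theta_sum:
  assumes "F = (\<Sum>j<J. smult (laurent (a j)) (theta j))" "\<exists>j<J. a j \<noteq> 0"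
  shows "degree F < J \<and> a (degree F) \<noteq> 0 \<and> F = (\<Sum>j\<le>degree F. smult (laurent (a j)) (theta j)) \<and> F \<noteq> 0"
  using assms
proof (induction J)
  case 0
  then show ?case by simp
next
  case (Suc J)
  show ?case
  proof (cases "a J = 0")
    case True
    then have "F = (\<Sum>j<J. smult (laurent (a j)) (theta j))" "\<exists>j<J. a j \<noteq> 0"
      using Suc.prems by (auto simp: laurent.hom_zero less_Suc_eq)
    then show ?thesis using Suc.IH by auto
  next
    case False
    define F1 where "F1 = (\<Sum>j<J. smult (laurent (a j)) (theta j))"
    have F: "F = F1 + smult (laurent (a J)) (theta J)"
      using Suc.prems by (simp add: F1_def)
    have c1: "coeff F1 i = 0" if "i \<ge> J" for i
      unfolding F1_def coeff_sum using that
      by (intro sum.neutral) (auto intro!: coeff_eq_0 simp: degree_theta)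
    have c2: "coeff F J = laurent (a J) * inverse fls_X ^ rho J"
      using lead_theta[of J] by (simp add: F c1 degree_theta)
    have c3: "coeff F i = 0" if "i > J" for i
      using that by (simp add: F c1 coeff_eq_0 degree_theta)
    have nz: "coeff F J \<noteq> 0"
      by (simp add: c2 False laurent_eq_0_iff)
    have "degree F = J"
      using le_degree[OF nz] degree_le[of J F] c3 by (metis antisym)
    then show ?thesis using False Suc.prems(1) nz by (auto simp: lessThan_Suc_atMost)
  qed
qed

lemma ev_sum_Theta: "ev (\<Sum>j<J. emb_X (a j) * Theta j) = (\<Sum>j<J. smult (laurent (a j)) (theta j))"
  by (simp add: ev.hom_sum ev.hom_mult ev_emb_X ev_Theta)

text \<open>
A normal form in the kernel vanishes by linear independence, so only the multiple of the relation is left.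
\<close>

lemma ev_eq_0_iff: "ev F = 0 \<longleftrightarrow> rel dvd F"
proof
  assume "rel dvd F"
  then show "ev F = 0" by (auto elim!: dvdE simp: ev.hom_mult ev_rel)
next
  assume 0: "ev F = 0"
  obtain q a J where F: "F = rel * q + (\<Sum>j<J. emb_X (a j) * Theta j)"
    using NF_expand[of F] by blast
  have "ev F = (\<Sum>j<J. smult (laurent (a j)) (theta j))"
    unfolding F by (simp add: ev.hom_add ev.hom_mult ev_rel ev_sum_Theta)
  then have "\<not> (\<exists>j<J. a j \<noteq> 0)"
    using degree_theta_sum[where F = "ev F" and J = J and a = a] 0 by auto
  then have "F = rel * q"
    unfolding F by (simp add: emb_X.hom_zero)
  then show "rel dvd F" by simp
qed

lemma B_expand: 
  assumes "F \<in> B"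
  shows "\<exists>a. F = (\<Sum>j\<le>degree F. smult (laurent (a j)) (theta j))"
proof -
  obtain G where G: "F = ev G" using assms by (auto simp: B_def)
  obtain q a J where *: "G = rel * q + (\<Sum>j<J. emb_X (a j) * Theta j)"
    using NF_expand[of G] by blast
  have F: "F = (\<Sum>j<J. smult (laurent (a j)) (theta j))"
    unfolding G * by (simp add: ev.hom_add ev.hom_mult ev_rel ev_sum_Theta)
  show ?thesis
  proof (cases "\<exists>j<J. a j \<noteq> 0")
    case True
    then show ?thesis using degree_theta_sum[OF F] by blast
  next
    case False
    then have "F = 0" using F by (simp add: laurent.hom_zero)
    then show ?thesis by (intro exI[of _ "\<lambda>_. 0"]) (simp add: laurent.hom_zero)
  qed
qed

text \<open>
Only the basis element of the same degree contributes to the leading coefficient.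
\<close>

lemma B_lead:
  assumes "F \<in> B"
  obtains a where "lead_coeff F = laurent a * inverse fls_X ^ rho (degree F)"
proof -
  obtain a where a: "F = (\<Sum>j\<le>degree F. smult (laurent (a j)) (theta j))"
    using B_expand[OF assms] by blast
  define k where "k = degree F"
  have "lead_coeff F = coeff (\<Sum>j\<le>k. smult (laurent (a j)) (theta j)) k"
    using a by (simp add: k_def)
  also have "\<dots> = (\<Sum>j\<le>k. if j = k then laurent (a k) * inverse fls_X ^ rho k else 0)"
    unfolding coeff_sum using lead_theta
    by (intro sum.cong) (auto simp: degree_theta coeff_eq_0)
  also have "\<dots> = laurent (a k) * inverse fls_X ^ rho k" by simp
  finally show ?thesis using that k_def by blast
qed

lemma B_lead_subdegree:
  assumes "F \<in> B" "F \<noteq> 0"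
  shows "fls_subdegree (lead_coeff F) \<ge> - int (rho (degree F))"
proof -
  obtain a where a: "lead_coeff F = laurent a * inverse fls_X ^ rho (degree F)"
    using B_lead[OF assms(1)] .
  have "laurent a \<noteq> 0" using a assms(2) by auto
  then have "fls_subdegree (lead_coeff F) = fls_subdegree (laurent a) - int (rho (degree F))"
    by (simp add: a fls_subdegree_pow)
  then show ?thesis using laurent_subdegree_nonneg[of a] by simp
qed

end

section \<open>Leading monomials of Laurent polynomials\<close>

text \<open>
Exponents of \<open>s\<close> are integers here, with coefficient 0 in negative degrees: applying a derivation shifts
exponents by a fixed vector, possibly below 0.
\<close>

definition monomial_coeff :: "'b::zero fls poly \<Rightarrow> int \<Rightarrow> int \<Rightarrow> 'b"
  where "monomial_coeff F j i = (if j < 0 then 0 else fls_nth (coeff F (nat j)) i)"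

text \<open>
The monomial \<open>c x\<^sup>i s\<^sup>j\<close> is leading for the order by degree in \<open>s\<close>, ties being broken in favour of
the smaller exponent of \<open>x\<close>. The case \<open>c = 0\<close> is included: it says that everything lies strictly
below \<open>(i, j)\<close>, and it makes the predicate stable under sums, products and derivatives.
\<close>

definition lead_at :: "'b::zero fls poly \<Rightarrow> int \<Rightarrow> int \<Rightarrow> 'b \<Rightarrow> bool"
  where "lead_at F i j c \<longleftrightarrow>
    (\<forall>j' i'. j < j' \<or> (j' = j \<and> i' < i) \<longrightarrow> monomial_coeff F j' i' = 0) \<and> monomial_coeff F j i = c"

abbreviation dx :: "'b::comm_ring_1 fls poly \<Rightarrow> 'b fls poly"
  where "dx \<equiv> map_poly fls_deriv"

lemma coeff_dx: "coeff (dx F) k = fls_deriv (coeff F k)"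
  by (simp add: coeff_map_poly)

lemma dx_add: "dx (F + G) = dx F + dx G"
  by (rule poly_eqI) (simp add: coeff_dx)

lemma dx_mult: "dx (F * G) = dx F * G + F * dx G"
  by (rule poly_eqI)
    (simp add: coeff_dx coeff_mult fls_deriv_sum sum.distrib add.commute)

lemma monomial_coeff_add:
  fixes F G :: "'b::comm_ring_1 fls poly"
  shows "monomial_coeff (F + G) j i = monomial_coeff F j i + monomial_coeff G j i"
  by (simp add: monomial_coeff_def)

lemma monomial_coeff_dx: "monomial_coeff (dx F) j i = of_int (i + 1) * monomial_coeff F j (i + 1)"
  by (simp add: monomial_coeff_def coeff_dx)

lemma monomial_coeff_pderiv:
  fixes F :: "'b::{comm_ring_1,semiring_no_zero_divisors} fls poly"
  shows "monomial_coeff (pderiv F) j i = of_int (j + 1) * monomial_coeff F (j + 1) i"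
proof (cases "j < 0")
  case True
  then show ?thesis by (cases "j = -1") (simp_all add: monomial_coeff_def)
next
  case False
  then have "nat (j + 1) = Suc (nat j)" "of_int (j + 1) = (of_nat (Suc (nat j)) :: 'b)"
    by simp_all
  moreover have "fls_nth (of_nat k * G) i = of_nat k * fls_nth G i" for k and G :: "'b fls"
    by (induction k) (simp_all add: distrib_right)
  ultimately show ?thesis
    using False by (simp only: monomial_coeff_def coeff_pderiv) simp
qed

lemma lead_at_add:
  "lead_at F i j a \<Longrightarrow> lead_at G i j b \<Longrightarrow> lead_at (F + G :: 'b::comm_ring_1 fls poly) i j (a + b)"
  by (auto simp: lead_at_def monomial_coeff_add)

lemma lead_at_dx: "lead_at F i j c \<Longrightarrow> lead_at (dx F) (i - 1) j (of_int i * c)"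
  by (auto simp: lead_at_def monomial_coeff_dx)

lemma lead_at_pderiv:
  "lead_at (F :: 'b::{comm_ring_1,semiring_no_zero_divisors} fls poly) i j c \<Longrightarrow>
    lead_at (pderiv F) i (j - 1) (of_int j * c)"
  by (auto simp: lead_at_def monomial_coeff_pderiv)

lemma lead_at_lower:
  "lead_at F i j c \<Longrightarrow> j < j' \<or> (j = j' \<and> i' < i) \<Longrightarrow> lead_at F i' j' 0"
  by (auto simp: lead_at_def)

lemma lead_at_zero: "lead_at 0 i j c \<longleftrightarrow> c = 0"
  by (auto simp: lead_at_def monomial_coeff_def)

lemma lead_at_lead_coeff:
  assumes "F \<noteq> 0"
  shows "lead_at F (fls_subdegree (lead_coeff F)) (int (degree F))
    (fls_nth (lead_coeff F) (fls_subdegree (lead_coeff F)))"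
    and "fls_nth (lead_coeff F) (fls_subdegree (lead_coeff F)) \<noteq> 0"
  using assms by (auto simp: lead_at_def monomial_coeff_def nat_eq_iff less_nat_zero_code zless_nat_eq_int_zless
      intro!: coeff_eq_0[THEN arg_cong[of _ 0 "\<lambda>f. fls_nth f _", simplified]])

lemma lead_at_coeffD:
  assumes "lead_at F i (int J) c"
  shows "k > J \<Longrightarrow> coeff F k = 0" and "i' < i \<Longrightarrow> fls_nth (coeff F J) i' = 0"
    and "fls_nth (coeff F J) i = c"
proof -
  show "k > J \<Longrightarrow> coeff F k = 0"
    using assms by (intro fls_eqI) (auto simp: lead_at_def monomial_coeff_def dest: spec[of _ "int k"])
  show "i' < i \<Longrightarrow> fls_nth (coeff F J) i' = 0"
    using assms by (auto simp: lead_at_def monomial_coeff_def dest: spec[of _ "int J"])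
  show "fls_nth (coeff F J) i = c"
    using assms by (auto simp: lead_at_def monomial_coeff_def)
qed

lemma lead_at_unique:
  assumes "lead_at F i j c" "c \<noteq> 0"
  shows "F \<noteq> 0" "j = int (degree F)" "i = fls_subdegree (lead_coeff F)"
proof -
  have "j \<ge> 0" using assms by (auto simp: lead_at_def monomial_coeff_def split: if_splits)
  then obtain J where J: "j = int J" by (metis nonneg_int_cases)
  note F = lead_at_coeffD[OF assms(1)[unfolded J]]
  have nz: "fls_nth (coeff F J) i \<noteq> 0" using F(3) assms(2) by simp
  then have J0: "coeff F J \<noteq> 0" by auto
  then show "F \<noteq> 0" by auto
  have "degree F = J"
    using le_degree[OF J0] degree_le[of J F] F(1) by (metis antisym)
  then show "j = int (degree F)" "i = fls_subdegree (lead_coeff F)"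
    using fls_subdegree_eqI[OF nz] F(2) by (simp_all add: J)
qed

text \<open>
The lower bounds \<open>i\<close> and \<open>j\<close> for the orders need not be attained; if one is not, both sides are 0.
\<close>

lemma fls_mult_low:
  fixes F G :: "'b::idom fls"
  assumes "\<And>k. k < i \<Longrightarrow> fls_nth F k = 0" "\<And>k. k < j \<Longrightarrow> fls_nth G k = 0"
  shows "k < i + j \<Longrightarrow> fls_nth (F * G) k = 0"
    and "fls_nth (F * G) (i + j) = fls_nth F i * fls_nth G j"
proof -
  have *: "(k < i + j \<longrightarrow> fls_nth (F * G) k = 0) \<and> fls_nth (F * G) (i + j) = fls_nth F i * fls_nth G j" for k
  proof (cases "F = 0 \<or> G = 0")
    case False
    then have s: "i \<le> fls_subdegree F" "j \<le> fls_subdegree G"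
      using assms by (auto intro: fls_subdegree_geI)
    have "fls_nth (F * G) (i + j) = fls_nth F i * fls_nth G j"
    proof (cases "i = fls_subdegree F \<and> j = fls_subdegree G")
      case True
      then show ?thesis by simp
    next
      case ne: False
      then have "i + j < fls_subdegree F + fls_subdegree G" 
        and "fls_nth F i = 0 \<or> fls_nth G j = 0"
        using s by (auto intro: fls_eq0_below_subdegree)
      then show ?thesis by (auto simp: fls_times_nth_eq0)
    qed
    then show ?thesis using s by (auto intro!: fls_times_nth_eq0)
  qed auto
  then show "k < i + j \<Longrightarrow> fls_nth (F * G) k = 0" 
    and "fls_nth (F * G) (i + j) = fls_nth F i * fls_nth G j" by blast+
qed

lemma lead_at_coeffI:
  assumes "\<And>k. k > J \<Longrightarrow> coeff F k = 0" "\<And>i'. i' < i \<Longrightarrow> fls_nth (coeff F J) i' = 0"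
    and "fls_nth (coeff F J) i = c"
  shows "lead_at F i (int J) c"
  using assms by (auto simp: lead_at_def monomial_coeff_def zless_nat_eq_int_zless)

lemma lead_at_neg:
  assumes "lead_at F i j c" "j < 0" shows "F = 0" "c = 0"
proof -
  show "c = 0" using assms by (auto simp: lead_at_def monomial_coeff_def)
  have "coeff F k = 0" for k
    using assms by (intro fls_eqI) (auto simp: lead_at_def monomial_coeff_def dest: spec[of _ "int k"])
  then show "F = 0" by (intro poly_eqI) simp
qed

lemma lead_at_mult:
  fixes F G :: "'b::idom fls poly"
  assumes "lead_at F i j a" "lead_at G i' j' b"
  shows "lead_at (F * G) (i + i') (j + j') (a * b)"
proof (cases "j < 0 \<or> j' < 0")
  case True
  then show ?thesis using assms lead_at_neg by (fastforce simp: lead_at_zero)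
next
  case False
  then obtain J J' where J: "j = int J" "j' = int J'"
    by (metis nonneg_int_cases not_less)
  note F = lead_at_coeffD[OF assms(1)[unfolded J]] and G = lead_at_coeffD[OF assms(2)[unfolded J]]
  have "coeff (F * G) (J + J') = coeff F J * coeff G J'"
  proof -
    have "coeff (F * G) (J + J') = (\<Sum>k\<le>J + J'. if k = J then coeff F J * coeff G J' else 0)"
      unfolding coeff_mult
    proof (rule sum.cong)
      fix k assume "k \<in> {..J + J'}"
      then show "coeff F k * coeff G (J + J' - k) = (if k = J then coeff F J * coeff G J' else 0)"
        using F(1)[of k] G(1)[of "J + J' - k"] by (cases k J rule: linorder_cases) auto
    qed simp
    also have "\<dots> = coeff F J * coeff G J'" by simp
    finally show ?thesis .
  qed
  moreover have "coeff (F * G) k = 0" if "k > J + J'" for k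
    unfolding coeff_mult
  proof (rule sum.neutral, rule ballI)
    fix l assume "l \<in> {..k}"
    then show "coeff F l * coeff G (k - l) = 0"
      using F(1)[of l] G(1)[of "k - l"] that by (cases "l > J") auto
  qed
  ultimately have "lead_at (F * G) (i + i') (int (J + J')) (a * b)"
    using fls_mult_low[of i "coeff F J" i' "coeff G J'"] F G by (intro lead_at_coeffI) auto
  then show ?thesis by (simp add: J)
qed

text \<open>
For a derivation \<open>a d/dx + b d/ds\<close> this finds the shift \<open>(p, q)\<close> of its top part, together with the
coefficients \<open>\<alpha>\<close>, \<open>\<beta>\<close> of that part
\<open>x\<^sup>p s\<^sup>q (\<alpha> x d/dx + \<beta> s d/ds)\<close>. Here \<open>p\<close> and \<open>q\<close> can be -1.
\<close>

lemma lead_at_leading_pair: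
  assumes "a \<noteq> 0 \<or> b \<noteq> 0"
  obtains p q \<alpha> \<beta> where "lead_at a (p + 1) q \<alpha>" "lead_at b p (q + 1) \<beta>" "\<alpha> \<noteq> 0 \<or> \<beta> \<noteq> 0"
proof -
  define ia ja ca where "ia = fls_subdegree (lead_coeff a)" "ja = int (degree a)" "ca = fls_nth (lead_coeff a) ia"
  define ib jb cb where "ib = fls_subdegree (lead_coeff b)" "jb = int (degree b)" "cb = fls_nth (lead_coeff b) ib"
  have A: "lead_at a ia ja ca \<and> ca \<noteq> 0" if "a \<noteq> 0"
    using lead_at_lead_coeff[OF that] by (simp add: ia_ja_ca_def)
  have Bb: "lead_at b ib jb cb \<and> cb \<noteq> 0" if "b \<noteq> 0"
    using lead_at_lead_coeff[OF that] by (simp add: ib_jb_cb_def)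
  consider "a = 0" "b \<noteq> 0" | "a \<noteq> 0" "b = 0" 
    | "a \<noteq> 0" "b \<noteq> 0" "ja < jb - 1 \<or> ja = jb - 1 \<and> ib < ia - 1"
    | "a \<noteq> 0" "b \<noteq> 0" "jb - 1 < ja \<or> ja = jb - 1 \<and> ia - 1 < ib"
    | "a \<noteq> 0" "b \<noteq> 0" "ja = jb - 1" "ia - 1 = ib"
    using assms by fastforce
  then show thesis
  proof cases
    case 1
    then show thesis using that[of ib "jb - 1" 0 cb] Bb by (simp add: lead_at_zero)
  next
    case 2
    then show thesis using that[of "ia - 1" ja ca 0] A by (simp add: lead_at_zero)
  next
    case 3
    then show thesis using that[of ib "jb - 1" 0 cb] A Bb
        lead_at_lower[of a ia ja ca "jb - 1" "ib + 1"] by fastforce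
  next
    case 4
    then show thesis using that[of "ia - 1" ja ca 0] A Bb
        lead_at_lower[of b ib jb cb "ja + 1" "ia - 1"] by fastforce
  next
    case 5
    then have "lead_at a (ia - 1 + 1) ja ca" "lead_at b (ia - 1) (ja + 1) cb" "ca \<noteq> 0"
      using A Bb by auto
    then show thesis using that by blast
  qed
qed

section \<open>Induction over the surface ring\<close>

context danielewski
begin

abbreviation x :: "'a fls poly" where "x \<equiv> [:fls_X:]"

lemma B_laurent: "[:laurent p:] \<in> B" and B_const: "[:fls_const c:] \<in> B" and B_x: "x \<in> B"
  and B_y: "y \<in> B" and B_z: "z \<in> B" and B_s: "s \<in> B"
  using ev_emb_X[of p] ev_const3[of c] ev_var_X ev_var_Y ev_var_Z ev_varS
  unfolding B_def by (metis rangeI)+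

lemma B_add: "F \<in> B \<Longrightarrow> G \<in> B \<Longrightarrow> F + G \<in> B"
  unfolding B_def by (auto simp flip: ev.hom_add)

lemma B_diff: "F \<in> B \<Longrightarrow> G \<in> B \<Longrightarrow> F - G \<in> B"
  unfolding B_def by (auto simp flip: ev.hom_diff)

lemma B_mult: "F \<in> B \<Longrightarrow> G \<in> B \<Longrightarrow> F * G \<in> B"
  unfolding B_def by (auto simp flip: ev.hom_mult)

lemma B_one: "1 \<in> B"
  unfolding B_def using ev.hom_one by (metis rangeI)

lemma B_zero: "0 \<in> B"
  unfolding B_def using ev.hom_zero by (metis rangeI)

lemma B_power: "F \<in> B \<Longrightarrow> F ^ k \<in> B"
  by (induction k) (simp_all add: B_one B_mult)

lemma B_sum: "(\<And>i. i \<in> I \<Longrightarrow> F i \<in> B) \<Longrightarrow> sum F I \<in> B"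
  by (induction I rule: infinite_finite_induct) (simp_all add: B_zero B_add)

lemma B_induct [consumes 1, case_names const Y Z add mult]:
  assumes "F \<in> B"
    and "\<And>p. Q [:laurent p:]" "Q y" "Q z"
    and "\<And>F G. F \<in> B \<Longrightarrow> G \<in> B \<Longrightarrow> Q F \<Longrightarrow> Q G \<Longrightarrow> Q (F + G)"
    and "\<And>F G. F \<in> B \<Longrightarrow> G \<in> B \<Longrightarrow> Q F \<Longrightarrow> Q G \<Longrightarrow> Q (F * G)"
  shows "Q F"
proof -
  have *: "ev H \<in> B" for H by (simp add: B_def)
  have "Q (ev H)" for H
    by (induction H rule: poly_XYZ_induct)
      (use assms(2-) * in \<open>simp_all add: ev.hom_add ev.hom_mult ev_emb_X ev_var_Y ev_var_Z B_y B_z\<close>)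
  then show ?thesis using assms(1) by (auto simp: B_def)
qed

text \<open>
Over \<open>k\<close>, the ring \<open>B\<close> is generated by \<open>x\<close> and \<open>s\<close> up to division by powers of \<open>x\<close>. A property
that can be cancelled by powers of \<open>x\<close> thus need not be checked for \<open>y\<close> and \<open>z\<close>.
\<close>

lemma B_induct_x_s [consumes 1, case_names const X S add mult cancel]:
  assumes "F \<in> B"
    and const: "\<And>c. Q [:fls_const c:]" and X: "Q x" and S: "Q s"
    and add: "\<And>F G. F \<in> B \<Longrightarrow> G \<in> B \<Longrightarrow> Q F \<Longrightarrow> Q G \<Longrightarrow> Q (F + G)"
    and mult: "\<And>F G. F \<in> B \<Longrightarrow> G \<in> B \<Longrightarrow> Q F \<Longrightarrow> Q G \<Longrightarrow> Q (F * G)"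
    and cancel: "\<And>F k. F \<in> B \<Longrightarrow> Q (x ^ k) \<Longrightarrow> Q (x ^ k * F) \<Longrightarrow> Q F"
  shows "Q F"
proof -
  define C where "C = {F \<in> B. Q F}"
  have C0: "[:fls_const c:] \<in> C" "x \<in> C" "s \<in> C" for c
    using const X S by (simp_all add: C_def B_const B_x B_s)
  have C_add: "F \<in> C \<Longrightarrow> G \<in> C \<Longrightarrow> F + G \<in> C" and C_mult: "F \<in> C \<Longrightarrow> G \<in> C \<Longrightarrow> F * G \<in> C" for F G
    using add mult by (simp_all add: C_def B_add B_mult)
  have C_1: "1 \<in> C" using C0(1)[of 1] by (simp add: one_pCons)
  have C_power: "F \<in> C \<Longrightarrow> F ^ k \<in> C" for F k
    by (induction k) (simp_all add: C_1 C_mult)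
  have C_cancel: "F \<in> C" if "F \<in> B" "x ^ k * F \<in> C" for F k
    using that cancel[of F k] C_power[OF C0(2), of k] by (simp add: C_def)
  have C_laurent: "[:laurent p:] \<in> C" for p
  proof (induction p)
    case 0
    show ?case using C0(1)[of 0] by (simp add: laurent.hom_zero)
  next
    case (pCons c p)
    have "[:laurent (pCons c p):] = [:fls_const c:] + x * [:laurent p:]"
      by (simp add: laurent_pCons)
    then show ?case using C_add C_mult C0 pCons.IH by metis
  qed
  have C_map: "map_poly laurent G \<in> C" for G
  proof (induction G)
    case 0
    show ?case using C0(1)[of 0] by simp
  next
    case (pCons p G)
    have "map_poly laurent (pCons p G) = [:laurent p:] + s * map_poly laurent G"
      by (simp add: map_poly_pCons laurent.hom_zero)
    then show ?case using C_add C_mult C0 C_laurent pCons.IH by metis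
  qed
  have y: "y \<in> C"
    using C_cancel[OF B_y, of n] C_map by (simp only: x_power_y Ps_def)
  have z: "z \<in> C"
  proof -
    have "fls_const (- 1 :: 'a) = - 1"
      by (intro fls_eqI) simp
    then have "y ^ m - s = y ^ m + [:fls_const (- 1):] * s"
      by simp
    then have "y ^ m - s \<in> C"
      using C_add[OF C_power[OF y] C_mult[OF C0(1) C0(3)]] by metis
    then show ?thesis using C_cancel[OF B_z, of e] by (simp only: x_power_z)
  qed
  have "F \<in> C" using assms(1)
    by (induction rule: B_induct) (simp_all add: C_laurent y z C_add C_mult)
  then show ?thesis by (simp add: C_def)
qed

lemma B_map_laurent: "map_poly laurent G \<in> B"
  using ev_subst_S[of G varS] by (simp add: ev_varS poly_map_const B_def) (metis rangeI)

end

section \<open>Locally nilpotent derivations\<close>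

text \<open>
\<open>G\<close> is the set of exponents of leading monomials, generated by those of \<open>x\<close>, \<open>s\<close>, \<open>y\<close>, \<open>z\<close>. A locally
nilpotent monomial derivation shifts exponents by \<open>(p, q)\<close> and lowers the weight \<open>A i + C j\<close> by 1 until it
reaches 0. If \<open>A > 0\<close>, then \<open>x\<close>, \<open>s\<close> and \<open>y\<close> have positive weight. Following \<open>x\<close> and \<open>s\<close> down
to weight 0 shows that \<open>z\<close> has weight 0 and then that \<open>A\<close>, \<open>C\<close> and the weight of \<open>y\<close> are at least 2.
But the orbit of \<open>x\<close> passes through an exponent of weight 1, which such generators cannot produce.
\<close>

lemma monomial_derivation_weight_zero:
  fixes n e m d A C p q :: int and G :: "(int \<times> int) set"
  assumes pos: "n \<ge> 1" "e \<ge> 1" "m \<ge> 2" "d \<ge> 2" "A \<ge> 0" "C \<ge> 0"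
    and pq: "A * p + C * q = -1"
    and gens: "(1, 0) \<in> G" "(0, 1) \<in> G" "(- n, d) \<in> G" "(- (n * m + e), d * m) \<in> G"
    and nonneg: "\<And>i j. (i, j) \<in> G \<Longrightarrow> A * i + C * j \<ge> 0"
    and chain: "\<And>i j t. (i, j) \<in> G \<Longrightarrow> 0 \<le> t \<Longrightarrow> t \<le> A * i + C * j \<Longrightarrow> (i + t * p, j + t * q) \<in> G"
    and generated: "\<And>i j. (i, j) \<in> G \<Longrightarrow> \<exists>a\<ge>0. \<exists>b\<ge>0. \<exists>c\<ge>0. \<exists>g\<ge>0.
      i = a - n * c - (n * m + e) * g \<and> j = b + d * c + d * m * g"
  shows "A = 0"
proof (rule ccontr)
  assume "A \<noteq> 0"
  then have A: "A \<ge> 1" using pos by simp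
  \<comment> \<open>The weights of the generators \<open>y\<close> and \<open>z\<close>.\<close>
  define vy where "vy = C * d - A * n"
  define vz where "vz = C * (d * m) - A * (n * m + e)"
  have vz_nonneg: "vz \<ge> 0" using nonneg[OF gens(4)] by (simp add: vz_def algebra_simps)
  have "m * vy = vz + A * e" by (simp add: vy_def vz_def algebra_simps)
  moreover have "A * e > 0" using A pos by simp
  ultimately have "m * vy > 0" using vz_nonneg by simp
  then have vy: "vy > 0" using pos by (simp add: zero_less_mult_iff)
  have "A * (n * m + e) \<noteq> 0" using A pos by (simp add: add_pos_pos less_imp_neq[symmetric])
  moreover have "A * (n * m + e) \<ge> 0" using A pos by simp
  ultimately have "C \<noteq> 0" using vz_nonneg by (auto simp: vz_def)
  then have C: "C \<ge> 1" using pos by simp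
  have rep: "\<exists>a\<ge>0. \<exists>b\<ge>0. \<exists>c\<ge>0. \<exists>g\<ge>0. i = a - n * c - (n * m + e) * g \<and> j = b + d * c + d * m * g
      \<and> A * i + C * j = A * a + C * b + vy * c + vz * g" if ij: "(i, j) \<in> G" for i j
  proof -
    obtain a b c g where *: "a \<ge> 0" "b \<ge> 0" "c \<ge> 0" "g \<ge> 0" 
      "i = a - n * c - (n * m + e) * g" "j = b + d * c + d * m * g"
      using generated[OF ij] by blast
    then have "A * i + C * j = A * a + C * b + vy * c + vz * g"
      by (simp only: vy_def vz_def) (simp add: algebra_simps)
    then show ?thesis using * by blast
  qed
  have G1: "(1 + A * p, A * q) \<in> G" using chain[OF gens(1), of A] A by simp
  have G2: "(C * p, 1 + C * q) \<in> G" using chain[OF gens(2), of C] C by simp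
  have w1: "A * (1 + A * p) + C * (A * q) = 0"
  proof -
    have "A * (1 + A * p) + C * (A * q) = A * (1 + (A * p + C * q))" by (simp add: algebra_simps)
    then show ?thesis by (simp add: pq)
  qed
  have w2: "A * (C * p) + C * (1 + C * q) = 0"
  proof -
    have "A * (C * p) + C * (1 + C * q) = C * (1 + (A * p + C * q))" by (simp add: algebra_simps)
    then show ?thesis by (simp add: pq)
  qed
  have zero_weight: "\<exists>g\<ge>0. i = - (n * m + e) * g \<and> j = d * m * g \<and> vz * g = 0"
    if ij: "(i, j) \<in> G" and w: "A * i + C * j = 0" for i j
  proof -
    obtain a b c g where *: "a \<ge> 0" "b \<ge> 0" "c \<ge> 0" "g \<ge> 0" 
      "i = a - n * c - (n * m + e) * g" "j = b + d * c + d * m * g"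
      "A * a + C * b + vy * c + vz * g = 0"
      using rep[OF ij] w by auto
    have "A * a \<ge> 0" "C * b \<ge> 0" "vy * c \<ge> 0" "vz * g \<ge> 0"
      using * A C vy vz_nonneg by simp_all
    then have "A * a = 0" "C * b = 0" "vy * c = 0" "vz * g = 0"
      using *(7) by linarith+
    then have "a = 0" "b = 0" "c = 0" using A C vy by simp_all
    then show ?thesis using * \<open>vz * g = 0\<close> by (intro exI[of _ g]) (simp add: algebra_simps)
  qed
  obtain g where g: "g \<ge> 0" "1 + A * p = - (n * m + e) * g" "A * q = d * m * g" "vz * g = 0"
    using zero_weight[OF G1 w1] by blast
  obtain h where h: "h \<ge> 0" "C * p = - (n * m + e) * h" "1 + C * q = d * m * h" "vz * h = 0"
    using zero_weight[OF G2 w2] by blast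
  \<comment> \<open>The endpoints of both orbits are multiples \<open>g\<close> and \<open>h\<close> of the exponent of \<open>z\<close>; \<open>K\<close> is the
    factor by which \<open>(A, C)\<close> is a multiple of \<open>(d m, n m + e)\<close>.\<close>
  define K where "K = A * h - C * g"
  have "A = A * (1 + C * q) - C * (A * q)" by (simp add: algebra_simps)
  also have "\<dots> = d * m * K" by (simp only: g h K_def) (simp add: algebra_simps)
  finally have AK: "A = d * m * K" .
  have "C = C * (1 + A * p) - A * (C * p)" by (simp add: algebra_simps)
  also have "\<dots> = (n * m + e) * K" by (simp only: g h K_def) (simp add: algebra_simps)
  finally have CK: "C = (n * m + e) * K" .
  have dm: "d * m \<ge> 2" "n * m + e \<ge> 2"
    using mult_mono[of 2 d 1 m] mult_mono[of 1 n 2 m] pos by simp_all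
  have K: "K \<ge> 1" 
  proof -
    have "d * m * K > 0" using AK A by simp
    then show ?thesis using dm by (simp add: zero_less_mult_iff)
  qed
  have A2: "A \<ge> 2" and C2: "C \<ge> 2"
    using mult_mono[of 2 "d * m" 1 K] mult_mono[of 2 "n * m + e" 1 K] AK CK K dm by simp_all
  have vz0: "vz = 0" by (simp add: vz_def AK CK algebra_simps)
  have "vy = d * (e * K)" by (simp add: vy_def AK CK algebra_simps)
  moreover have "e * K \<ge> 1" using mult_mono[of 1 e 1 K] pos K by simp
  ultimately have vy2: "vy \<ge> 2" using mult_mono[of 2 d 1 "e * K"] pos by simp
  have G3: "(1 + (A - 1) * p, (A - 1) * q) \<in> G" using chain[OF gens(1), of "A - 1"] A by simp
  have "A * (1 + (A - 1) * p) + C * ((A - 1) * q) = A + (A - 1) * (A * p + C * q)"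
    by (simp add: algebra_simps)
  also have "\<dots> = 1" by (simp add: pq)
  finally obtain a b c where *: "a \<ge> 0" "b \<ge> 0" "c \<ge> 0" "A * a + C * b + vy * c = 1"
    using rep[OF G3] vz0 by auto
  have "A * a \<ge> 2 * a" "C * b \<ge> 2 * b" "vy * c \<ge> 2 * c"
    using * A2 C2 vy2 by (simp_all add: mult_right_mono)
  then have "a = 0" "b = 0" "c = 0" using * by linarith+
  then show False using * by simp
qed

context danielewski
begin

text \<open>
The two sides are derivations that agree on \<open>x\<close> and \<open>s\<close>, and a power of \<open>x\<close> can be cancelled.
\<close>

lemma derivation_formula:
  assumes D_B: "\<And>F. F \<in> B \<Longrightarrow> D F \<in> B"
    and D_add: "\<And>F G. F \<in> B \<Longrightarrow> G \<in> B \<Longrightarrow> D (F + G) = D F + D G"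
    and D_mult: "\<And>F G. F \<in> B \<Longrightarrow> G \<in> B \<Longrightarrow> D (F * G) = D F * G + F * D G"
    and D_const: "\<And>c. D [:fls_const c:] = 0"
    and F: "F \<in> B"
  shows "D F = D x * dx F + D s * pderiv F"
  using F
proof (induction rule: B_induct_x_s)
  case (const c)
  then show ?case by (simp add: D_const pderiv_pCons map_poly_pCons)
next
  case X
  then show ?case by (simp add: pderiv_pCons map_poly_pCons)
next
  case S
  then show ?case by (simp add: pderiv_pCons map_poly_pCons)
next
  case (add F G)
  then show ?case by (simp add: D_add dx_add pderiv_add algebra_simps)
next
  case (mult F G)
  then show ?case by (simp add: D_mult dx_mult pderiv_mult algebra_simps)
next
  case (cancel F k)
  have "D (x ^ k) * F + x ^ k * D F = D (x ^ k * F)"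
    using D_mult[OF B_power[OF B_x] cancel(1)] by simp
  also have "\<dots> = D x * dx (x ^ k * F) + D s * pderiv (x ^ k * F)"
    by (rule cancel)
  also have "\<dots> = (D x * dx (x ^ k) + D s * pderiv (x ^ k)) * F + x ^ k * (D x * dx F + D s * pderiv F)"
    by (simp add: dx_mult pderiv_mult algebra_simps del: const_power)
  also have "D x * dx (x ^ k) + D s * pderiv (x ^ k) = D (x ^ k)"
    using cancel(2) by simp
  finally have "x ^ k * D F = x ^ k * (D x * dx F + D s * pderiv F)"
    by (simp only: add_left_cancel)
  moreover have "x ^ k \<noteq> 0" by simp
  ultimately show ?case using mult_left_cancel by blast
qed

definition lead_set :: "(int \<times> int) set"
  where "lead_set = {(i, j). \<exists>F\<in>B. \<exists>c. c \<noteq> 0 \<and> lead_at F i j c}"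

lemma lead_set_I:
  assumes "F \<in> B" "F \<noteq> 0"
  shows "(fls_subdegree (lead_coeff F), int (degree F)) \<in> lead_set"
  using assms lead_at_lead_coeff[OF assms(2)] unfolding lead_set_def by blast

lemma lead_set_gens:
  "(1, 0) \<in> lead_set" "(0, 1) \<in> lead_set" "(- int n, int d) \<in> lead_set"
  "(- (int n * int m + int e), int d * int m) \<in> lead_set"
  using lead_set_I[OF B_x] lead_set_I[OF B_s] lead_set_I[OF B_y y_nz] lead_set_I[OF B_z z_nz]
  by (simp_all only: lead_y lead_z) (simp_all add: degree_y degree_z fls_subdegree_pow)

lemma lead_set_generated:
  assumes "(i, j) \<in> lead_set"
  shows "\<exists>a\<ge>0. \<exists>b\<ge>0. \<exists>c\<ge>0. \<exists>g\<ge>0. i = a - int n * c - (int n * int m + int e) * g 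
    \<and> j = b + int d * c + int d * int m * g"
proof -
  obtain F c where F: "F \<in> B" "c \<noteq> 0" "lead_at F i j c"
    using assms by (auto simp: lead_set_def)
  note l = lead_at_unique[OF F(3,2)]
  define k where "k = degree F"
  have i: "i + int (rho k) \<ge> 0" 
    using B_lead_subdegree[OF F(1) l(1)] l(3) by (simp add: k_def)
  have "k = k mod d + d * ((k div d) mod m + m * (k div d div m))" by simp
  also have "\<dots> = k mod d + d * ((k div d) mod m) + d * m * (k div (d * m))"
    by (simp only: div_mult2_eq distrib_left mult.assoc add.assoc)
  finally have "int k = int (k mod d) + int d * int ((k div d) mod m) + int d * int m * int (k div (d * m))"
    by (metis of_nat_add of_nat_mult)
  then show ?thesis
    using l(2) i
    by (intro exI[of _ "i + int (rho k)"] exI[of _ "int (k mod d)"] exI[of _ "int ((k div d) mod m)"]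
        exI[of _ "int (k div (d * m))"] conjI) (simp_all add: k_def[symmetric] rho_def)
qed

text \<open>
The shift and the coefficients \<open>\<alpha>\<close>, \<open>\<beta>\<close> of the top part describe the action of \<open>D\<close> on leading
monomials: \<open>(i, j)\<close> goes to \<open>(i + p, j + q)\<close> with the factor \<open>\<alpha> i + \<beta> j\<close>. By nilpotency some factor
vanishes along each orbit. For \<open>x\<close> and \<open>s\<close> this makes \<open>\<alpha>\<close> and \<open>\<beta>\<close> natural multiples of a common
scalar, and the weights are integral. As the weight of \<open>x\<close> vanishes, the top part is a monomial times
\<open>d/ds\<close>, and it kills only monomials of degree 0 in \<open>s\<close>.
\<close>

lemma derivation_kernel_degree_0:
  assumes D_B: "\<And>F. F \<in> B \<Longrightarrow> D F \<in> B"
    and D_add: "\<And>F G. F \<in> B \<Longrightarrow> G \<in> B \<Longrightarrow> D (F + G) = D F + D G"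
    and D_mult: "\<And>F G. F \<in> B \<Longrightarrow> G \<in> B \<Longrightarrow> D (F * G) = D F * G + F * D G"
    and D_const: "\<And>c. D [:fls_const c:] = 0"
    and nilp: "\<And>F. F \<in> B \<Longrightarrow> \<exists>N. (D ^^ N) F = 0"
    and nonzero: "\<exists>F\<in>B. D F \<noteq> 0"
    and ker: "F \<in> B" "D F = 0"
  shows "degree F = 0"
proof -
  have formula: "D F = D x * dx F + D s * pderiv F" if "F \<in> B" for F
    by (rule derivation_formula[where D = D]) (use D_B D_add D_mult D_const that in simp_all)
  have "D x \<noteq> 0 \<or> D s \<noteq> 0" using nonzero formula by auto
  then obtain p q \<alpha> \<beta> where la: "lead_at (D x) (p + 1) q \<alpha>" and lb: "lead_at (D s) p (q + 1) \<beta>"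
    and nz: "\<alpha> \<noteq> 0 \<or> \<beta> \<noteq> 0"
    by (rule lead_at_leading_pair)
  have step: "lead_at (D F) (i + p) (j + q) (c * (\<alpha> * of_int i + \<beta> * of_int j))"
    if "F \<in> B" "lead_at F i j c" for F i j c
  proof -
    have "lead_at (D x * dx F) (i + p) (j + q) (\<alpha> * (of_int i * c))"
      using lead_at_mult[OF la lead_at_dx[OF that(2)]] by (simp add: algebra_simps)
    moreover have "lead_at (D s * pderiv F) (i + p) (j + q) (\<beta> * (of_int j * c))"
      using lead_at_mult[OF lb lead_at_pderiv[OF that(2)]] by (simp add: algebra_simps)
    ultimately have "lead_at (D F) (i + p) (j + q) (\<alpha> * (of_int i * c) + \<beta> * (of_int j * c))"
      unfolding formula[OF that(1)] by (rule lead_at_add)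
    then show ?thesis by (simp add: algebra_simps)
  qed
  \<comment> \<open>The change of the factor from one step of an orbit to the next.\<close>
  define \<kappa> where "\<kappa> = \<alpha> * of_int p + \<beta> * of_int q"
  have iter_B: "(D ^^ r) F \<in> B" if "F \<in> B" for F r
    using that by (induction r) (simp_all add: D_B)
  have iter: "lead_at ((D ^^ r) F) (i + int r * p) (j + int r * q)
      (c * (\<Prod>t<r. \<alpha> * of_int i + \<beta> * of_int j + of_nat t * \<kappa>))"
    if "F \<in> B" "lead_at F i j c" for F i j c r
  proof (induction r)
    case 0
    then show ?case using that by simp
  next
    case (Suc r)
    have "\<alpha> * of_int (i + int r * p) + \<beta> * of_int (j + int r * q)
        = \<alpha> * of_int i + \<beta> * of_int j + of_nat r * \<kappa>"
      by (simp add: \<kappa>_def algebra_simps)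
    then show ?case
      using step[OF iter_B[OF that(1)] Suc.IH] by (simp add: algebra_simps)
  qed
  have chain: "\<exists>r. \<alpha> * of_int i + \<beta> * of_int j + of_nat r * \<kappa> = 0
      \<and> (\<forall>t\<le>r. (i + int t * p, j + int t * q) \<in> lead_set)" if ij: "(i, j) \<in> lead_set" for i j
  proof -
    obtain F c where F: "F \<in> B" "c \<noteq> 0" "lead_at F i j c"
      using ij by (auto simp: lead_set_def)
    let ?P = "\<lambda>r. \<alpha> * of_int i + \<beta> * of_int j + of_nat r * \<kappa> = 0"
    obtain N where "(D ^^ N) F = 0" using nilp[OF F(1)] by blast
    then have "c * (\<Prod>t<N. \<alpha> * of_int i + \<beta> * of_int j + of_nat t * \<kappa>) = 0"
      using iter[OF F(1,3), of N] by (simp only: lead_at_zero)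
    then have ex: "\<exists>r. ?P r" using F(2) by (auto simp: prod_zero_iff)
    define r where "r = (LEAST r. ?P r)"
    have r: "?P r" unfolding r_def using ex by (rule LeastI_ex)
    have least: "\<not> ?P t" if "t < r" for t
      using not_less_Least that unfolding r_def by blast
    have "(i + int t * p, j + int t * q) \<in> lead_set" if "t \<le> r" for t
    proof -
      have "c * (\<Prod>t<t. \<alpha> * of_int i + \<beta> * of_int j + of_nat t * \<kappa>) \<noteq> 0"
        using F(2) least that by auto
      then show ?thesis using iter[OF F(1,3), of t] iter_B[OF F(1), of t] 
        unfolding lead_set_def by blast
    qed
    then show ?thesis using r by blast
  qed
  obtain r where r: "\<alpha> + of_nat r * \<kappa> = 0" using chain[OF lead_set_gens(1)] by auto
  obtain r' where r': "\<beta> + of_nat r' * \<kappa> = 0" using chain[OF lead_set_gens(2)] by auto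
  have \<kappa>: "\<kappa> \<noteq> 0" using nz r r' by auto
  have \<alpha>: "\<alpha> = - of_nat r * \<kappa>" and \<beta>: "\<beta> = - of_nat r' * \<kappa>"
    using r r' by (simp_all add: eq_neg_iff_add_eq_0)
  have weight_iff: "\<alpha> * of_int i + \<beta> * of_int j + of_nat t * \<kappa> = 0 \<longleftrightarrow> int r * i + int r' * j = int t" for i j t
  proof -
    have "\<alpha> * of_int i + \<beta> * of_int j + of_nat t * \<kappa> = of_int (int t - (int r * i + int r' * j)) * \<kappa>"
      by (simp add: \<alpha> \<beta> algebra_simps)
    then show ?thesis using \<kappa> by (simp only: mult_eq_0_iff of_int_eq_0_iff) auto
  qed
  have pq: "int r * p + int r' * q = -1"
  proof -
    have "\<kappa> = \<alpha> * of_int p + \<beta> * of_int q" by (rule \<kappa>_def)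
    also have "\<dots> = - (of_int (int r * p + int r' * q) * \<kappa>)"
      by (simp add: \<alpha> \<beta> algebra_simps)
    finally have "of_int (int r * p + int r' * q) * \<kappa> + \<kappa> = 0"
      by (metis add.right_inverse)
    then have "of_int (int r * p + int r' * q + 1) * \<kappa> = 0"
      by (simp only: of_int_add distrib_right of_int_1 mult_1_left)
    then have "int r * p + int r' * q + 1 = 0"
      using \<kappa> by (simp only: mult_eq_0_iff of_int_eq_0_iff) auto
    then show ?thesis by simp
  qed
  have "int r = 0"
  proof (rule monomial_derivation_weight_zero[of "int n" "int e" "int m" "int d" "int r" "int r'" p q lead_set])
    fix i j assume ij: "(i, j) \<in> lead_set"
    obtain t where t: "int r * i + int r' * j = int t" 
      "\<And>u. u \<le> t \<Longrightarrow> (i + int u * p, j + int u * q) \<in> lead_set"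
      using chain[OF ij] weight_iff by auto
    show "int r * i + int r' * j \<ge> 0" using t by simp
    show "(i + u * p, j + u * q) \<in> lead_set" if "0 \<le> u" "u \<le> int r * i + int r' * j" for u
      using t(2)[of "nat u"] that t(1) by (simp add: nat_le_iff)
  qed (use n_pos e_pos m_ge_2 d_ge_2 pq lead_set_gens lead_set_generated in simp_all)
  then have \<alpha>0: "\<alpha> = 0" and \<beta>0: "\<beta> \<noteq> 0" using \<alpha> nz by simp_all
  show "degree F = 0"
  proof (cases "F = 0")
    case False
    define c where "c = fls_nth (lead_coeff F) (fls_subdegree (lead_coeff F))"
    have c: "c \<noteq> 0" "lead_at F (fls_subdegree (lead_coeff F)) (int (degree F)) c"
      using lead_at_lead_coeff[OF False] by (simp_all add: c_def)
    have "c * (\<beta> * of_nat (degree F)) = 0"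
      using step[OF ker(1) c(2)] ker(2) by (simp add: \<alpha>0 lead_at_zero)
    then show ?thesis using c \<beta>0 by simp
  qed simp
qed


section \<open>The derivation \<open>x\<^sup>n\<^sup>+\<^sup>e d/ds\<close>\<close>

text \<open>
The factor \<open>x\<^sup>n\<^sup>+\<^sup>e\<close> clears the denominators of the derivatives of \<open>y\<close> and \<open>z\<close>.
\<close>

definition delta :: "'a fls poly \<Rightarrow> 'a fls poly"
  where "delta F = smult (fls_X ^ (n + e)) (pderiv F)"

lemma delta_add: "delta (F + G) = delta F + delta G"
  by (simp add: delta_def pderiv_add smult_add_right)

lemma delta_mult: "delta (F * G) = delta F * G + F * delta G"
  by (simp add: delta_def pderiv_mult smult_add_right mult.commute)

lemma B_of_nat: "of_nat k \<in> B"
  by (induction k) (simp_all add: B_zero B_one B_add)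

lemma pderiv_Ps_B: "pderiv Ps \<in> B"
proof -
  have "laurent (of_nat k :: 'a poly) = of_nat k" for k
    by (induction k) (simp_all add: laurent.hom_zero laurent.hom_one laurent.hom_add)
  then have "pderiv Ps = map_poly laurent (pderiv P)"
    by (intro poly_eqI)
      (simp add: coeff_pderiv coeff_map_poly laurent.hom_zero coeff_Ps laurent.hom_mult
        laurent.hom_add laurent.hom_one)
  then show ?thesis by (simp add: B_map_laurent)
qed

lemma delta_y: "delta y = x ^ e * pderiv Ps"
proof -
  have "fls_X ^ (n + e) * inverse (fls_X ^ n) = (fls_X ^ e :: 'a fls)"
    by (simp add: power_add)
  then show ?thesis by (simp add: delta_def y_def pderiv_smult const_power)
qed

lemma delta_z: "delta z = of_nat m * y ^ (m - 1) * pderiv Ps - x ^ n"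
proof -
  obtain k where m: "m = Suc k" using m_ge_2 by (cases m) auto
  have 1: "x ^ e * delta z = delta (y ^ m - s)"
    using delta_mult[of "x ^ e" z]
    by (simp only: x_power_z) (simp add: delta_def const_power pderiv_pCons)
  have 2: "pderiv (y ^ m) = of_nat m * y ^ k * pderiv y"
    unfolding m pderiv_power_Suc by (simp only: of_nat_mult_conv_smult[symmetric] mult.assoc[symmetric])
  have "delta (y ^ m - s) = of_nat m * y ^ k * delta y - x ^ (n + e)"
    by (simp add: delta_def pderiv_diff 2 smult_diff_right pderiv_pCons const_power)
  also have "\<dots> = x ^ e * (of_nat m * y ^ k * pderiv Ps - x ^ n)"
    unfolding delta_y by (simp only: power_add) (simp only: algebra_simps)
  finally have "x ^ e * delta z = x ^ e * (of_nat m * y ^ k * pderiv Ps - x ^ n)"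
    using 1 by simp
  moreover have "x ^ e \<noteq> 0" by simp
  ultimately show ?thesis using m by (simp only: mult_left_cancel) simp
qed

lemma delta_B: "F \<in> B \<Longrightarrow> delta F \<in> B"
proof (induction rule: B_induct)
  case (const p)
  show ?case by (simp add: delta_def pderiv_pCons B_zero)
next
  case Y
  then show ?case unfolding delta_y by (intro B_mult B_power B_x pderiv_Ps_B)
next
  case Z
  show ?case unfolding delta_z
    by (intro B_diff B_mult B_power B_x B_y pderiv_Ps_B B_of_nat)
next
  case (add F G)
  then show ?case by (simp add: delta_add B_add)
next
  case (mult F G)
  then show ?case by (simp add: delta_mult B_add B_mult)
qed

lemma delta_nilpotent: "degree F < N \<Longrightarrow> (delta ^^ N) F = 0"
proof (induction N arbitrary: F)
  case (Suc N)
  show ?case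
  proof (cases "degree F = 0")
    case True
    have "(delta ^^ k) 0 = 0" for k by (induction k) (simp_all add: delta_def)
    moreover have "delta F = 0" using True by (simp add: delta_def pderiv_eq_0_iff)
    ultimately show ?thesis by (simp add: funpow_Suc_right del: funpow.simps)
  next
    case False
    then have "degree (delta F) < N"
      using Suc.prems by (simp add: delta_def degree_pderiv)
    then show ?thesis using Suc.IH by (simp add: funpow_Suc_right del: funpow.simps)
  qed
qed simp

section \<open>Elements of low degree\<close>

lemma theta_small: "j < d \<Longrightarrow> theta j = s ^ j"
  using m_ge_2 by (simp add: theta_def div_less less_le_trans[of j d "d * m"])

lemma theta_d: "theta d = y"
  using m_ge_2 d_ge_2 by (simp add: theta_def)

lemma rho_small: "j < d \<Longrightarrow> rho j = 0"
  using m_ge_2 by (simp add: rho_def less_le_trans[of j d "d * m"])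

lemma rho_d: "rho d = n"
  using m_ge_2 d_ge_2 by (simp add: rho_def)

lemma rho_dm: "rho (d * m) = n * m + e"
  using m_ge_2 d_ge_2 by (simp add: rho_def)

lemma theta_sum_small:
  assumes "k \<le> d"
  shows "\<exists>A. degree A < max 1 k \<and> (\<Sum>j<k. smult (laurent (a j)) (theta j)) = map_poly laurent A"
proof -
  define A where "A = (\<Sum>j<k. Polynomial.monom (a j) j)"
  have c: "coeff A i = (if i < k then a i else 0)" for i
    by (simp add: A_def coeff_sum)
  have "(\<Sum>j<k. smult (laurent (a j)) (theta j)) = (\<Sum>j<k. Polynomial.monom (laurent (a j)) j)"
    using assms by (intro sum.cong) (auto simp: theta_small monom_altdef)
  also have "\<dots> = map_poly laurent A"
    by (rule poly_eqI) (simp add: coeff_sum coeff_map_poly laurent.hom_zero c)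
  finally have "(\<Sum>j<k. smult (laurent (a j)) (theta j)) = map_poly laurent A" .
  moreover have "degree A < max 1 k"
  proof -
    have "degree A \<le> k - 1" by (rule degree_le) (auto simp: c)
    then show ?thesis by simp
  qed
  ultimately show ?thesis by blast
qed

lemma B_small_degree:
  assumes "F \<in> B" "degree F < d"
  obtains A where "F = map_poly laurent A" "degree A = degree F"
proof -
  obtain a where a: "F = (\<Sum>j\<le>degree F. smult (laurent (a j)) (theta j))"
    using B_expand[OF assms(1)] by blast
  obtain A where A: "F = map_poly laurent A"
    using theta_sum_small[of "Suc (degree F)" a] assms(2) a by (auto simp: lessThan_Suc_atMost)
  moreover have "degree (map_poly laurent A) = degree A"
    by (rule degree_map_poly) (simp add: laurent_eq_0_iff)
  ultimately show ?thesis using that by simp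
qed

lemma B_degree_d:
  assumes "F \<in> B" "degree F = d"
  obtains A u where "F = map_poly laurent A + smult (laurent u) y" "degree A < d"
proof -
  obtain a where a: "F = (\<Sum>j\<le>d. smult (laurent (a j)) (theta j))"
    using B_expand[OF assms(1)] assms(2) by auto
  then have F: "F = (\<Sum>j<d. smult (laurent (a j)) (theta j)) + smult (laurent (a d)) y"
    by (simp add: lessThan_Suc_atMost[symmetric] theta_d)
  obtain A where "degree A < max 1 d" "(\<Sum>j<d. smult (laurent (a j)) (theta j)) = map_poly laurent A"
    using theta_sum_small[of d a] by blast
  then show ?thesis using that[of A "a d"] F d_ge_2 by simp
qed

end

section \<open>The shape of an isomorphism\<close>

text \<open>
An isomorphism of \<open>k\<close>-algebras between two surface rings with the same \<open>m\<close>, together with its inverse. The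
description is symmetric, so each statement about \<open>h\<close> also holds for \<open>h'\<close>.
\<close>

locale danielewski_iso =
  one: danielewski n1 e1 m d1 f + two: danielewski n2 e2 m d2 g
  for n1 e1 m d1 :: nat and f :: "nat \<Rightarrow> 'a::field_char_0 poly"
    and n2 e2 d2 :: nat and g :: "nat \<Rightarrow> 'a poly" +
  fixes h h' :: "'a fls poly \<Rightarrow> 'a fls poly"
  assumes h_B: "F \<in> one.B \<Longrightarrow> h F \<in> two.B" and h'_B: "G \<in> two.B \<Longrightarrow> h' G \<in> one.B"
    and h'_h: "F \<in> one.B \<Longrightarrow> h' (h F) = F" and h_h': "G \<in> two.B \<Longrightarrow> h (h' G) = G"
    and h_add: "F \<in> one.B \<Longrightarrow> F' \<in> one.B \<Longrightarrow> h (F + F') = h F + h F'"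
    and h_mult: "F \<in> one.B \<Longrightarrow> F' \<in> one.B \<Longrightarrow> h (F * F') = h F * h F'"
    and h_const: "h [:fls_const c:] = [:fls_const c:]"
begin

lemma h'_add: "F \<in> two.B \<Longrightarrow> G \<in> two.B \<Longrightarrow> h' (F + G) = h' F + h' G"
  by (metis h_add h'_B h'_h h_h' one.B_add)

lemma h'_mult: "F \<in> two.B \<Longrightarrow> G \<in> two.B \<Longrightarrow> h' (F * G) = h' F * h' G"
  by (metis h_mult h'_B h'_h h_h' one.B_mult)

lemma h'_const: "h' [:fls_const c:] = [:fls_const c:]"
  by (metis h_const h'_h one.B_const)

lemma flip: "danielewski_iso n2 e2 m d2 g n1 e1 d1 f h' h"
  by unfold_locales (simp_all add: h_B h'_B h_h' h'_h h'_add h'_mult h'_const)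

lemma h_zero: "h 0 = 0" and h_one: "h 1 = 1"
  using h_const[of 0] h_const[of 1] by (simp_all add: one_pCons)

lemma h_power: "F \<in> one.B \<Longrightarrow> h (F ^ k) = h F ^ k"
  by (induction k) (simp_all add: h_one h_mult one.B_power)

lemma h_laurent:
  assumes "h one.x = [:laurent a:]"
  shows "h [:laurent p:] = [:laurent (pcompose p a):]"
proof (induction p)
  case 0
  show ?case by (simp add: laurent.hom_zero h_zero)
next
  case (pCons c p)
  have "[:laurent (pCons c p):] = [:fls_const c:] + one.x * [:laurent p:]"
    by (simp add: laurent_pCons)
  then have "h [:laurent (pCons c p):] = h [:fls_const c:] + h one.x * h [:laurent p:]"
    by (simp only: h_add h_mult one.B_const one.B_mult one.B_x one.B_laurent)
  then show ?case
    by (simp add: h_const assms pCons.IH pcompose_pCons laurent.hom_add laurent.hom_mult laurent_const)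
qed

lemma h_map_laurent:
  assumes "h one.x = [:laurent a:]"
  shows "h (map_poly laurent Q) = pcompose (map_poly laurent (map_poly (\<lambda>p. pcompose p a) Q)) (h one.s)"
proof (induction Q)
  case 0
  show ?case by (simp add: h_zero)
next
  case (pCons p Q)
  have "map_poly laurent (pCons p Q) = [:laurent p:] + one.s * map_poly laurent Q"
    by (simp add: map_poly_pCons laurent.hom_zero)
  then have "h (map_poly laurent (pCons p Q)) = h [:laurent p:] + h one.s * h (map_poly laurent Q)"
    by (simp only: h_add h_mult one.B_mult one.B_s one.B_laurent one.B_map_laurent)
  then show ?case
    by (simp add: h_laurent[OF assms] pCons.IH pcompose_pCons map_poly_pCons laurent.hom_zero)
qed

text \<open>
The transport of \<open>delta\<close> along the isomorphism; its kernel contains \<open>h x\<close>.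
\<close>

definition D :: "'a fls poly \<Rightarrow> 'a fls poly"
  where "D F = h (one.delta (h' F))"

lemma D_B: "F \<in> two.B \<Longrightarrow> D F \<in> two.B"
  by (simp add: D_def h_B one.delta_B h'_B)

lemma D_add: "F \<in> two.B \<Longrightarrow> G \<in> two.B \<Longrightarrow> D (F + G) = D F + D G"
  by (simp add: D_def h'_add one.delta_add h_add one.delta_B h'_B)

lemma D_mult: "F \<in> two.B \<Longrightarrow> G \<in> two.B \<Longrightarrow> D (F * G) = D F * G + F * D G"
  by (simp add: D_def h'_mult one.delta_mult h_add h_mult one.delta_B h'_B one.B_mult h_h')

lemma D_const: "D [:fls_const c:] = 0"
  by (simp add: D_def h'_const one.delta_def pderiv_pCons h_zero)

lemma D_h: "F \<in> one.B \<Longrightarrow> D (h F) = h (one.delta F)"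
  by (simp add: D_def h'_h)

lemma D_nilpotent:
  assumes "F \<in> two.B" shows "\<exists>N. (D ^^ N) F = 0"
proof -
  have 1: "(one.delta ^^ N) (h' F) \<in> one.B \<and> (D ^^ N) F = h ((one.delta ^^ N) (h' F))" for N
    by (induction N) (simp_all add: assms h_h' h'_B D_h one.delta_B)
  show ?thesis
    using 1[of "Suc (degree (h' F))"] one.delta_nilpotent[of "h' F" "Suc (degree (h' F))"]
    by (metis h_zero lessI)
qed

lemma D_h_s: "D (h one.s) = h one.x ^ (n1 + e1)"
  by (simp add: D_h one.B_s one.delta_def pderiv_pCons h_power[OF one.B_x, symmetric] const_power)

lemma h_nonzero: "F \<in> one.B \<Longrightarrow> F \<noteq> 0 \<Longrightarrow> h F \<noteq> 0"
  by (metis h_zero h'_h one.B_zero)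

lemma D_h_s_nonzero: "D (h one.s) \<noteq> 0"
  using h_nonzero[OF one.B_x] by (simp add: D_h_s)

lemma D_h_x: "D (h one.x) = 0"
  by (simp add: D_h one.B_x one.delta_def pderiv_pCons h_zero)

lemma h_x_poly: "\<exists>a. h one.x = [:laurent a:]"
proof -
  have "degree (h one.x) = 0"
  proof (rule two.derivation_kernel_degree_0[of D])
    show "\<exists>F\<in>two.B. D F \<noteq> 0" using D_h_s_nonzero h_B[OF one.B_s] by blast
  qed (fact D_B D_add D_mult D_const D_nilpotent D_h_x h_B[OF one.B_x])+
  moreover obtain A where "h one.x = map_poly laurent A" "degree A = degree (h one.x)"
    using two.B_small_degree[OF h_B[OF one.B_x]] \<open>degree (h one.x) = 0\<close> two.d_ge_2 by auto
  ultimately obtain a where "h one.x = map_poly laurent [:a:]"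
    by (metis degree_eq_zeroE)
  then show ?thesis by (auto simp: map_poly_pCons laurent.hom_zero)
qed

text \<open>
Both \<open>h x\<close> and \<open>h' x\<close> are polynomials in \<open>x\<close>, and these are inverse to each other under composition.
\<close>

lemma h_x_linear: "\<exists>c l. l \<noteq> 0 \<and> h one.x = [:laurent [:c, l:]:]"
proof -
  obtain a where a: "h one.x = [:laurent a:]" using h_x_poly by blast
  obtain a' where a': "h' two.x = [:laurent a':]" using danielewski_iso.h_x_poly[OF flip] by blast
  have "h (h' two.x) = [:laurent (pcompose a' a):]"
    by (simp add: a' h_laurent[OF a])
  then have "laurent (pcompose a' a) = laurent [:0, 1:]"
    using h_h'[OF two.B_x] by (simp add: laurent_X)
  then have "degree (pcompose a' a) = 1" by (simp add: laurent_eq_iff)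
  then have "degree a = 1" by (simp add: degree_pcompose)
  then obtain c l where "a = [:c, l:]" "l \<noteq> 0"
    by (metis degree1_coeffs)
  then show ?thesis using a by blast
qed

text \<open>
Since \<open>x\<close> is a polynomial in \<open>h x\<close>, the transported derivation kills \<open>x\<close> and is a multiple of \<open>d/ds\<close>.
Its value on \<open>h s\<close> is \<open>(h x)\<^sup>n\<^sup>+\<^sup>e\<close>, which has degree 0 in \<open>s\<close>; so \<open>h s\<close> has degree 1.
\<close>

lemma h_s_degree: "\<exists>b u. u \<noteq> 0 \<and> h one.s = [:laurent b, laurent u:]"
proof -
  obtain a' where a': "h' two.x = [:laurent a':]"
    using danielewski_iso.h_x_poly[OF flip] by blast
  have Dx: "D two.x = 0"
    unfolding D_def a' by (simp add: one.delta_def pderiv_pCons h_zero)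
  have "D (h one.s) = D two.x * dx (h one.s) + D two.s * pderiv (h one.s)"
    by (rule two.derivation_formula[OF D_B D_add D_mult D_const h_B[OF one.B_s]])
  then have eq: "D two.s * pderiv (h one.s) = h one.x ^ (n1 + e1)"
    unfolding Dx D_h_s by simp
  have "D two.s * pderiv (h one.s) \<noteq> 0"
    unfolding eq D_h_s[symmetric] by (rule D_h_s_nonzero)
  then have nz: "D two.s \<noteq> 0" "pderiv (h one.s) \<noteq> 0" by (metis mult_zero_left, metis mult_zero_right)
  have "degree (h one.x) = 0" using h_x_poly by (metis degree_pCons_0)
  then have "degree (h one.x ^ (n1 + e1)) = 0"
    using degree_power_le[of "h one.x" "n1 + e1"] by simp
  then have "degree (pderiv (h one.s)) = 0"
    using degree_mult_eq[OF nz] unfolding eq by linarith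
  then have deg: "degree (h one.s) = 1"
    using nz(2) unfolding degree_pderiv pderiv_eq_0_iff by linarith
  then have "degree (h one.s) < d2" using two.d_ge_2 by linarith
  then obtain A where A: "h one.s = map_poly laurent A" "degree A = degree (h one.s)"
    by (rule two.B_small_degree[OF h_B[OF one.B_s]])
  obtain u b where "A = [:b, u:]" "u \<noteq> 0"
    using degree1_coeffs[of A] A(2) deg by metis
  then have "h one.s = [:laurent b, laurent u:]"
    unfolding A(1) by (simp add: map_poly_pCons laurent.hom_zero)
  then show ?thesis using \<open>u \<noteq> 0\<close> by blast
qed

text \<open>
The same holds for \<open>h'\<close>, so the coefficient of \<open>s\<close> in \<open>h s\<close> is a unit of \<open>k[x]\<close>.
\<close>

lemma h_s_linear: "\<exists>b u. u \<noteq> 0 \<and> h one.s = [:laurent b, fls_const u:]"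
proof -
  obtain a where a: "h one.x = [:laurent a:]" using h_x_poly by blast
  obtain b u where u: "h one.s = [:laurent b, laurent u:]" using h_s_degree by blast
  obtain b' u' where u': "h' two.s = [:laurent b', laurent u':]"
    using danielewski_iso.h_s_degree[OF flip] by blast
  have "h' two.s = map_poly laurent [:b', u':]"
    by (simp add: u' map_poly_pCons laurent.hom_zero)
  then have "h (h' two.s) = [:laurent (pcompose b' a) + laurent (pcompose u' a) * laurent b,
      laurent (pcompose u' a) * laurent u:]"
    by (simp only: h_map_laurent[OF a] u)
      (simp add: map_poly_pCons laurent.hom_zero pcompose_pCons mult.commute)
  then have "laurent (pcompose u' a * u) = laurent 1"
    using h_h'[OF two.B_s] by (simp add: laurent.hom_mult laurent.hom_one)
  then have "u dvd 1" by (metis laurent_eq_iff dvd_triv_right)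
  then obtain c where "u = [:c:]" "c dvd 1" by (rule is_unit_polyE)
  then have "c \<noteq> 0" by auto
  then show ?thesis using u \<open>u = [:c:]\<close> by (auto simp: laurent_const)
qed

text \<open>
Apply \<open>h\<close> to \<open>x\<^sup>n y = P(x, s)\<close>: the right-hand side becomes a monic polynomial of degree \<open>d1\<close> composed
with the linear polynomial \<open>h s\<close>.
\<close>

lemma h_y_lead:
  assumes hx: "h one.x = [:laurent a:]" and hs: "h one.s = [:laurent b, fls_const u:]" "u \<noteq> 0"
  shows "degree (h one.y) = d1" "lead_coeff (h one.y) * laurent a ^ n1 = fls_const (u ^ d1)"
proof -
  let ?Q = "map_poly laurent (map_poly (\<lambda>p. pcompose p a) one.P)"
  have eq: "[:laurent a:] ^ n1 * h one.y = pcompose ?Q (h one.s)"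
    using h_mult[OF one.B_power[OF one.B_x] one.B_y, of n1] h_map_laurent[OF hx, of one.P]
    by (simp only: one.x_power_y h_power[OF one.B_x] hx one.Ps_def)
  have c: "coeff ?Q i = laurent (pcompose (coeff one.P i) a)" for i
    by (simp add: coeff_map_poly laurent.hom_zero)
  have Q: "degree ?Q = d1" "lead_coeff ?Q = 1"
  proof -
    show "degree ?Q = d1"
      by (rule antisym[OF degree_le le_degree])
       (auto simp: c coeff_monic_poly one.d_ge_2 laurent.hom_zero laurent.hom_one pcompose_1)
    then show "lead_coeff ?Q = 1"
      by (simp add: c coeff_monic_poly one.d_ge_2 laurent.hom_one pcompose_1)
  qed
  have s: "degree (h one.s) = 1" "lead_coeff (h one.s) = fls_const u"
    using hs by simp_all
  have a: "laurent a \<noteq> 0" using h_nonzero[OF one.B_x] hx by auto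
  have smult: "[:laurent a:] ^ n1 * h one.y = smult (laurent a ^ n1) (h one.y)"
    by (simp add: const_power)
  have "degree (smult (laurent a ^ n1) (h one.y)) = d1"
    by (simp only: smult[symmetric] eq degree_pcompose Q s)
  then show "degree (h one.y) = d1" using a by simp
  have "lead_coeff (smult (laurent a ^ n1) (h one.y)) = fls_const u ^ d1"
    using lead_coeff_comp[of "h one.s" ?Q] s Q by (simp only: smult[symmetric] eq) simp
  then show "lead_coeff (h one.y) * laurent a ^ n1 = fls_const (u ^ d1)"
    by (simp only: lead_coeff_smult fls_const_power mult.commute)
qed

text \<open>
If \<open>c \<noteq> 0\<close>, the leading coefficient of \<open>h y\<close> would have a pole at the zero \<open>- c / l\<close> of \<open>c + l x\<close>,
whereas leading coefficients in the surface ring have poles only at \<open>x = 0\<close>.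
\<close>

lemma h_x_scaling:
  obtains l where "l \<noteq> 0" "h one.x = [:laurent [:0, l:]:]"
proof -
  obtain c l where cl: "l \<noteq> 0" "h one.x = [:laurent [:c, l:]:]" using h_x_linear by blast
  obtain b u where bu: "u \<noteq> 0" "h one.s = [:laurent b, fls_const u:]" using h_s_linear by blast
  note y = h_y_lead[OF cl(2) bu(2,1)]
  obtain A where A: "lead_coeff (h one.y) = laurent A * inverse fls_X ^ two.rho d1"
    using two.B_lead[OF h_B[OF one.B_y]] y(1) by auto
  have "laurent A * laurent [:c, l:] ^ n1
      = laurent A * inverse fls_X ^ two.rho d1 * laurent [:c, l:] ^ n1 * fls_X ^ two.rho d1"
    by (simp add: power_inverse)
  also have "\<dots> = fls_const (u ^ d1) * fls_X ^ two.rho d1"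
    using y(2) A by simp
  finally have "laurent (A * [:c, l:] ^ n1) = laurent ([:u ^ d1:] * [:0, 1:] ^ two.rho d1)"
    by (simp only: laurent.hom_mult laurent.hom_power laurent_const laurent_X)
  then have "A * [:c, l:] ^ n1 = [:u ^ d1:] * [:0, 1:] ^ two.rho d1"
    by (simp only: laurent_eq_iff)
  then have "poly (A * [:c, l:] ^ n1) (- c / l) = poly ([:u ^ d1:] * [:0, 1:] ^ two.rho d1) (- c / l)"
    by simp
  then have "c = 0"
    using cl(1) bu(1) one.n_pos by (simp add: zero_power)
  then show ?thesis using that cl by simp
qed

lemma h_y_subdegree: "degree (h one.y) = d1" "fls_subdegree (lead_coeff (h one.y)) = - int n1"
proof -
  obtain l where l: "l \<noteq> 0" "h one.x = [:laurent [:0, l:]:]" by (rule h_x_scaling)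
  obtain b u where bu: "u \<noteq> 0" "h one.s = [:laurent b, fls_const u:]" using h_s_linear by blast
  note y = h_y_lead[OF l(2) bu(2,1)]
  show "degree (h one.y) = d1" by (rule y)
  have s: "fls_subdegree (laurent [:0, l:] ^ n1) = int n1" "laurent [:0, l:] \<noteq> 0"
    using l(1) by (simp_all add: laurent_linear fls_subdegree_pow)
  have "lead_coeff (h one.y) \<noteq> 0" using h_nonzero[OF one.B_y one.y_nz] by simp
  then have "fls_subdegree (lead_coeff (h one.y)) + int n1 = fls_subdegree (fls_const (u ^ d1))"
    using s by (simp add: y(2)[symmetric])
  then show "fls_subdegree (lead_coeff (h one.y)) = - int n1" by simp
qed

lemma h_z_subdegree: "degree (h one.z) = d1 * m"
  "fls_subdegree (lead_coeff (h one.z)) = - int (n1 * m + e1)"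
proof -
  obtain l where l: "l \<noteq> 0" "h one.x = [:laurent [:0, l:]:]" by (rule h_x_scaling)
  obtain b u where bu: "u \<noteq> 0" "h one.s = [:laurent b, fls_const u:]" using h_s_linear by blast
  have s: "fls_subdegree (laurent [:0, l:] ^ e1) = int e1" "laurent [:0, l:] ^ e1 \<noteq> 0"
    using l(1) by (simp_all add: laurent_linear fls_subdegree_pow)
  have eq: "smult (laurent [:0, l:] ^ e1) (h one.z) = h one.y ^ m - h one.s"
  proof -
    have "h (one.x ^ e1 * one.z + one.s) = h (one.y ^ m)" by (simp only: one.x_power_z diff_add_cancel)
    then have "h one.x ^ e1 * h one.z + h one.s = h one.y ^ m"
      by (simp only: h_add h_mult h_power one.B_mult one.B_power one.B_x one.B_y one.B_z one.B_s)
    then have "h one.x ^ e1 * h one.z = h one.y ^ m - h one.s" by (simp only: eq_diff_eq)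
    then show ?thesis by (simp add: l(2) const_power)
  qed
  have hy: "h one.y \<noteq> 0" using h_nonzero[OF one.B_y one.y_nz] .
  have dm: "degree (h one.y ^ m) = d1 * m" using hy by (simp add: degree_power_eq h_y_subdegree(1))
  have lt: "degree (h one.s) < degree (h one.y ^ m)"
    using one.dm_gt by (simp only: dm bu) (simp add: bu(1))
  have "degree (smult (laurent [:0, l:] ^ e1) (h one.z)) = d1 * m"
    unfolding eq degree_lead_diff[OF lt] dm ..
  then show "degree (h one.z) = d1 * m"
    by (simp only: degree_smult_eq s(2) if_False)
  have "lead_coeff (smult (laurent [:0, l:] ^ e1) (h one.z)) = lead_coeff (h one.y) ^ m"
    unfolding eq degree_lead_diff(2)[OF lt] by (rule lead_coeff_power)
  then have "laurent [:0, l:] ^ e1 * lead_coeff (h one.z) = lead_coeff (h one.y) ^ m"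
    by (simp only: lead_coeff_smult)
  then have "fls_subdegree (laurent [:0, l:] ^ e1 * lead_coeff (h one.z)) = int m * (- int n1)"
    by (simp only: fls_subdegree_pow h_y_subdegree(2))
  moreover have "lead_coeff (h one.z) \<noteq> 0" using h_nonzero[OF one.B_z one.z_nz] by simp
  ultimately show "fls_subdegree (lead_coeff (h one.z)) = - int (n1 * m + e1)"
    using s by (simp add: mult.commute)
qed

text \<open>
The leading coefficients of \<open>h y\<close> and \<open>h z\<close> have poles of orders \<open>n1\<close> and \<open>n1 m + e1\<close>.
\<close>

lemma pole_orders_le: "n1 \<le> two.rho d1" "n1 * m + e1 \<le> two.rho (d1 * m)"
proof -
  show "n1 \<le> two.rho d1"
    using two.B_lead_subdegree[OF h_B[OF one.B_y] h_nonzero[OF one.B_y one.y_nz]]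
    unfolding h_y_subdegree(2) unfolding h_y_subdegree(1) by linarith
  show "n1 * m + e1 \<le> two.rho (d1 * m)"
    using two.B_lead_subdegree[OF h_B[OF one.B_z] h_nonzero[OF one.B_z one.z_nz]]
    unfolding h_z_subdegree(2) unfolding h_z_subdegree(1) by linarith
qed

text \<open>
Below degree \<open>d2\<close> the second ring has no leading coefficient with a pole.
\<close>

lemma degree_parameter_le: "d2 \<le> d1"
  using pole_orders_le(1) two.rho_small[of d1] one.n_pos by (cases "d1 < d2") auto

lemma parameters_eq: "d1 = d2" "n1 = n2" "e1 = e2"
proof -
  show d: "d1 = d2" using degree_parameter_le danielewski_iso.degree_parameter_le[OF flip] by simp
  have 1: "n1 \<le> n2" "n1 * m + e1 \<le> n2 * m + e2"
    using pole_orders_le two.rho_d two.rho_dm by (simp_all add: d)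
  have 2: "n2 \<le> n1" "n2 * m + e2 \<le> n1 * m + e1"
    using danielewski_iso.pole_orders_le[OF flip] one.rho_d one.rho_dm by (simp_all add: d)
  show "n1 = n2" using 1 2 by simp
  then show "e1 = e2" using 1 2 by simp
qed

end

section \<open>Polynomials in a power of the variable\<close>

lemma coeff_pcompose_monom_one:
  fixes R :: "'b::comm_ring_1 poly"
  assumes "m > 0"
  shows "coeff (pcompose R (Polynomial.monom 1 m)) k = (if m dvd k then coeff R (k div m) else 0)"
proof (induction R arbitrary: k)
  case 0
  show ?case by simp
next
  case (pCons a R)
  show ?case
  proof (cases "k < m")
    case True
    then show ?thesis using assms
      by (cases "k = 0") (auto simp: pcompose_pCons coeff_monom_mult coeff_pCons' dest: dvd_imp_le)
  next
    case False
    then obtain j where k: "k = m + j" using le_Suc_ex not_less by blast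
    show ?thesis using assms
      by (simp add: k pcompose_pCons coeff_monom_mult coeff_pCons' pCons.IH)
  qed
qed

lemma coeff_monom_mult_pcompose:
  fixes R :: "'b::comm_ring_1 poly"
  assumes "r < m" "i < m"
  shows "coeff (Polynomial.monom 1 r * pcompose R (Polynomial.monom 1 m)) (m * j + i)
    = (if i = r then coeff R j else 0)"
proof (cases "m * j + i < r")
  case True
  then show ?thesis using assms by (cases j) (auto simp: coeff_monom_mult)
next
  case False
  have "m dvd m * j + i - r \<longleftrightarrow> i = r"
  proof
    assume dv: "m dvd m * j + i - r"
    show "i = r"
    proof (cases "i \<ge> r")
      case True
      then have "m * j + i - r = m * j + (i - r)" by simp
      then have "m dvd i - r" using dv by (simp add: dvd_add_right_iff)
      then show ?thesis using True assms by (auto dest!: dvd_imp_le)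
    next
      case ir: False
      then have "m * j + i - r + (r - i) = m * j" using False by simp
      then have "m dvd r - i" using dv by (metis dvd_add_right_iff dvd_triv_left)
      then show ?thesis using ir assms by (auto dest!: dvd_imp_le)
    qed
  qed simp
  then show ?thesis using False assms by (simp add: coeff_monom_mult coeff_pcompose_monom_one)
qed

text \<open>
The exponents modulo \<open>m\<close> grade the polynomial ring, and \<open>Q(Y\<^sup>m)\<close> is homogeneous of degree 0, so it
divides a sum only if it divides every homogeneous part. Concretely, replace each \<open>E r\<close> by its remainder
modulo \<open>Q\<close>: the sum then has smaller degree than \<open>Q(Y\<^sup>m)\<close> and must vanish.
\<close>

lemma pcompose_monom_dvd_sum:
  fixes Q :: "'b::field poly"
  assumes m: "m > 0" and Q: "Q \<noteq> 0" and r: "r < m"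
    and dv: "pcompose Q (Polynomial.monom 1 m) dvd
      (\<Sum>r<m. Polynomial.monom 1 r * pcompose (E r) (Polynomial.monom 1 m))"
  shows "Q dvd E r"
proof -
  let ?c = "\<lambda>p. pcompose p (Polynomial.monom 1 m)"
  define T where "T = (\<Sum>r<m. Polynomial.monom 1 r * ?c (E r mod Q))"
  have eq: "?c (E r) = ?c Q * ?c (E r div Q) + ?c (E r mod Q)" for r
    unfolding pcompose_mult[symmetric] pcompose_add[symmetric] by simp
  define U where "U = (\<Sum>r<m. Polynomial.monom 1 r * ?c (E r div Q))"
  have "(\<Sum>r<m. Polynomial.monom 1 r * ?c (E r)) = ?c Q * U + T"
    unfolding T_def U_def eq distrib_left sum.distrib sum_distrib_left by (simp only: mult.left_commute)
  then have "?c Q dvd ?c Q * U + T" using dv by (simp only:)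
  then have "?c Q dvd T" by (simp only: dvd_add_right_iff[OF dvd_triv_left])
  have coeff_T: "coeff T (m * j + i) = coeff (E i mod Q) j" if "i < m" for i j
  proof -
    have "coeff T (m * j + i) = (\<Sum>r<m. if i = r then coeff (E r mod Q) j else 0)"
      unfolding T_def coeff_sum using that
      by (intro sum.cong) (simp_all only: coeff_monom_mult_pcompose lessThan_iff)
    then show ?thesis using that by simp
  qed
  have "T = 0"
  proof (rule ccontr)
    assume T: "T \<noteq> 0"
    define k where "k = degree T"
    have "degree (?c Q) \<le> k" using \<open>?c Q dvd T\<close> T by (simp add: dvd_imp_degree_le k_def)
    then have "m * degree Q \<le> k" by (simp add: degree_pcompose degree_monom_eq mult.commute)
    then have le: "degree Q \<le> k div m" using m by (simp add: less_eq_div_iff_mult_less_eq mult.commute)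
    have "coeff T k = coeff (E (k mod m) mod Q) (k div m)"
      using coeff_T[of "k mod m" "k div m"] m by simp
    also have "\<dots> = 0"
      using degree_mod_less[OF Q, of "E (k mod m)"] le by (auto intro: coeff_eq_0)
    finally show False using T by (simp add: k_def)
  qed
  then have "E r mod Q = 0"
    using coeff_T[OF r] by (intro poly_eqI) simp
  then show ?thesis by (simp add: dvd_eq_mod_eq_0)
qed

lemma pcompose_dvd_diff:
  fixes p :: "'b::comm_ring_1 poly"
  shows "q - q' dvd pcompose p q - pcompose p q'"
proof (induction p)
  case (pCons a p)
  have "pcompose (pCons a p) q - pcompose (pCons a p) q' =
      (q - q') * pcompose p q + q' * (pcompose p q - pcompose p q')"
    by (simp add: pcompose_pCons algebra_simps)
  then show ?case using pCons.IH by simp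
qed simp

lemma pcompose_monom_one: "pcompose (Polynomial.monom 1 k) q = (q :: 'b::comm_ring_1 poly) ^ k"
  by (induction k) (simp_all add: monom_0 one_pCons[symmetric] monom_Suc pcompose_pCons pcompose_1)

section \<open>Reduction modulo \<open>X\<close> and \<open>Z\<close>\<close>

text \<open>
The substitution \<open>X \<mapsto> 0\<close>, \<open>Z \<mapsto> 0\<close>. It sends the defining relation to \<open>- P(0, Y\<^sup>m)\<close>, hence detects
divisibility by \<open>x\<close> in the surface ring.
\<close>

definition red :: "'a::field poly poly poly \<Rightarrow> 'a poly"
  where "red F = map_poly (\<lambda>p. poly p 0) (poly F 0)"

lemma cring_hom_poly_at: "cring_hom (\<lambda>p. poly p (c :: 'b::comm_ring_1))"
  by unfold_locales simp_all

lemma cring_hom_red: "cring_hom red"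
  unfolding red_def
  by (rule cring_hom_comp[OF cring_hom_poly_at cring_hom.cring_hom_map_poly[OF cring_hom_poly_at]])

interpretation red: cring_hom red
  by (rule cring_hom_red)

lemma red_emb_X: "red (emb_X p) = [:poly p 0:]"
  by (simp add: red_def emb_X_def map_poly_pCons)

lemma red_vars: "red var_X = 0" "red var_Y = Polynomial.monom 1 1" "red var_Z = 0" "red (const3 c) = [:c:]"
  by (simp_all add: var_X_def const3_def red_emb_X)
    (simp_all add: red_def var_Y_def var_Z_def map_poly_pCons monom_Suc)

lemma red_subst_S: "red (subst_S Q w) = pcompose (map_poly (\<lambda>p. poly p 0) Q) (red w)"
  by (simp add: subst_S_def red.hom_poly map_poly_map_poly o_def red_emb_X pcompose_altdef
      red.hom_zero emb_X.hom_zero)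

context danielewski
begin

abbreviation P0 :: "'a poly" where "P0 \<equiv> map_poly (\<lambda>p. poly p 0) P"

lemma red_varS: "red varS = Polynomial.monom 1 m"
  using e_pos by (simp add: varS_def red.hom_diff red.hom_mult red.hom_power red_vars monom_power)

lemma red_rel: "red rel = - pcompose P0 (Polynomial.monom 1 m)"
  using n_pos
  by (simp add: rel_def red.hom_diff red.hom_mult red.hom_power red_vars red_varS red_subst_S)

lemma degree_P0: "degree P0 = d"
  by (rule antisym[OF degree_le le_degree])
    (auto simp: coeff_map_poly coeff_monic_poly d_ge_2)

end

section \<open>The congruences forced by an isomorphism\<close>

text \<open>
The parameters \<open>n\<close>, \<open>e\<close>, \<open>d\<close> agree, and \<open>h x\<close> and \<open>h s\<close> have the form that every isomorphism has.
\<close>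

locale danielewski_iso_eq = danielewski_iso n e m d f n e d g h h'
  for n e m d :: nat and f g :: "nat \<Rightarrow> 'a::field_char_0 poly" and h h' +
  fixes l u :: 'a and b :: "'a poly"
  assumes l: "l \<noteq> 0" and u: "u \<noteq> 0"
    and hx: "h one.x = [:laurent [:0, l:]:]" and hs: "h one.s = [:laurent b, fls_const u:]"
begin

definition v :: 'a where "v = u ^ d / l ^ n"

lemma v_nz: "v \<noteq> 0" by (simp add: v_def l u)

lemma h_x: "h one.x = smult (fls_const l) one.x"
  by (simp add: hx laurent_linear)

lemma h_y_decomp: "\<exists>A. degree A < d \<and> h one.y = smult (fls_const v) two.y + map_poly laurent A"
proof -
  obtain A w where A: "h one.y = map_poly laurent A + smult (laurent w) two.y" "degree A < d"
    by (rule two.B_degree_d[OF h_B[OF one.B_y] h_y_subdegree(1)])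
  have "coeff (h one.y) d = laurent w * inverse fls_X ^ n"
    using A(2) two.lead_y by (simp add: A(1) coeff_map_poly laurent.hom_zero coeff_eq_0 two.degree_y)
  then have "laurent w * inverse fls_X ^ n * (fls_const l * fls_X) ^ n = fls_const (u ^ d)"
    using h_y_lead[OF hx hs u] by (simp add: laurent_linear)
  then have "laurent w * fls_const (l ^ n) * (inverse fls_X ^ n * fls_X ^ n) = fls_const (u ^ d)"
    by (simp only: power_mult_distrib fls_const_power ac_simps)
  moreover have "inverse fls_X ^ n * fls_X ^ n = (1 :: 'a fls)" by (simp add: power_inverse)
  ultimately have "laurent w * fls_const (l ^ n) = fls_const (u ^ d)" by simp
  then have "laurent (w * [:l ^ n:]) = laurent [:u ^ d:]"
    by (simp only: laurent.hom_mult laurent_const)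
  then have w: "w * [:l ^ n:] = [:u ^ d:]" by (simp only: laurent_eq_iff)
  have "w = w * [:l ^ n:] * [:inverse (l ^ n):]"
    using l by (simp add: one_pCons[symmetric])
  also have "\<dots> = [:v:]" unfolding w by (simp add: v_def field_simps)
  finally have "w = [:v:]" .
  then show ?thesis using A by (auto simp: laurent_const add.commute)
qed

text \<open>
The expansion of \<open>(v y + x\<^sup>t A)\<^sup>m\<close> without the term \<open>(v y)\<^sup>m\<close>, divided by \<open>x\<^sup>t\<close> and lifted to
\<open>k[X,Y,Z]\<close>.
\<close>

definition binomial_rest :: "nat \<Rightarrow> 'a poly poly \<Rightarrow> 'a poly poly poly"
  where "binomial_rest t A = (\<Sum>r<m. of_nat (m choose r) * const3 (v ^ r) * var_Y ^ r
    * var_X ^ (t * (m - r - 1)) * subst_S A two.varS ^ (m - r))"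

lemma h_y_power:
  assumes hy: "h one.y = smult (fls_const v) two.y + two.x ^ t * map_poly laurent A"
  shows "h one.y ^ m = smult (fls_const (v ^ m)) (two.y ^ m) + two.x ^ t * two.ev (binomial_rest t A)"
proof -
  let ?A = "map_poly laurent A" and ?y = "smult (fls_const v) two.y"
  have hom_nat: "two.ev (of_nat k) = of_nat k" for k
    by (induction k) (simp_all add: two.ev.hom_zero two.ev.hom_one two.ev.hom_add)
  have pw: "smult (fls_const v) two.y ^ r = [:fls_const (v ^ r):] * two.y ^ r" for r
    by (simp add: smult_power fls_const_power)
  have "h one.y ^ m = (\<Sum>r\<le>m. of_nat (m choose r) * ?y ^ r * (two.x ^ t * ?A) ^ (m - r))"
    unfolding hy by (rule binomial_ring)
  also have "\<dots> = (\<Sum>r<m. of_nat (m choose r) * ?y ^ r * (two.x ^ t * ?A) ^ (m - r)) + ?y ^ m"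
    by (simp add: lessThan_Suc_atMost[symmetric])
  also have "?y ^ m = smult (fls_const (v ^ m)) (two.y ^ m)"
    by (simp add: pw)
  also have "(\<Sum>r<m. of_nat (m choose r) * ?y ^ r * (two.x ^ t * ?A) ^ (m - r)) =
      two.x ^ t * two.ev (binomial_rest t A)"
    unfolding binomial_rest_def two.ev.hom_sum sum_distrib_left
  proof (rule sum.cong)
    fix r assume "r \<in> {..<m}"
    then have "t * (m - r) = t + t * (m - r - 1)"
      by (cases "m - r") auto
    then have X: "(two.x ^ t * ?A) ^ (m - r) = two.x ^ t * two.x ^ (t * (m - r - 1)) * ?A ^ (m - r)"
      unfolding power_mult_distrib power_mult[symmetric] by (simp only: power_add)
    show "of_nat (m choose r) * ?y ^ r * (two.x ^ t * ?A) ^ (m - r) =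
        two.x ^ t * two.ev (of_nat (m choose r) * const3 (v ^ r) * var_Y ^ r
          * var_X ^ (t * (m - r - 1)) * subst_S A two.varS ^ (m - r))"
      unfolding X pw two.ev.hom_mult two.ev.hom_power hom_nat two.ev_const3 two.ev_var_Y
        two.ev_var_X two.ev_subst_S two.ev_varS poly_map_const
      by (simp only: ac_simps)
  qed simp
  finally show ?thesis by (simp only: add.commute)
qed

text \<open>
Both \<open>(h y)\<^sup>m - h s\<close> and \<open>y\<^sup>m - s\<close> are divisible by \<open>x\<^sup>e\<close>, so \<open>h s - v\<^sup>m s\<close> is divisible by
\<open>x\<^sup>t\<close> for \<open>t \<le> e\<close>. The quotient lies in the surface ring and has degree at most 1 in \<open>s\<close>, hence it is
a polynomial in \<open>x\<close> and \<open>s\<close>.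
\<close>

lemma h_s_congruence:
  assumes hy: "h one.y = smult (fls_const v) two.y + two.x ^ t * map_poly laurent A" and t: "t \<le> e"
  shows "\<exists>Q. \<exists>G\<in>two.B. h one.s - smult (fls_const (v ^ m)) two.s = two.x ^ t * map_poly laurent Q
    \<and> map_poly laurent Q = two.ev (binomial_rest t A) - two.x ^ (e - t) * G"
proof -
  define G where "G = [:fls_const (l ^ e):] * h one.z - [:fls_const (v ^ m):] * two.z"
  have G: "G \<in> two.B"
    unfolding G_def by (intro two.B_diff two.B_mult two.B_const two.B_z h_B one.B_z)
  define W where "W = two.ev (binomial_rest t A) - two.x ^ (e - t) * G"
  have W: "W \<in> two.B" unfolding W_def
    by (intro two.B_diff two.B_mult two.B_power two.B_x G) (simp add: two.B_def)
  have "h (one.x ^ e * one.z + one.s) = h (one.y ^ m)" by (simp only: one.x_power_z diff_add_cancel)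
  then have "h one.x ^ e * h one.z + h one.s = h one.y ^ m"
    by (simp only: h_add h_mult h_power one.B_mult one.B_power one.B_x one.B_y one.B_z one.B_s)
  moreover have "h one.x ^ e = two.x ^ e * [:fls_const (l ^ e):]"
    by (simp add: h_x const_power fls_const_power power_mult_distrib mult.commute)
  ultimately have 1: "two.x ^ e * ([:fls_const (l ^ e):] * h one.z) + h one.s = 
      [:fls_const (v ^ m):] * two.y ^ m + two.x ^ t * two.ev (binomial_rest t A)"
    using h_y_power[OF hy] by (simp add: mult.assoc)
  have 2: "two.y ^ m = two.x ^ e * two.z + two.s" by (simp only: two.x_power_z diff_add_cancel)
  have "two.x ^ t * W = two.x ^ t * two.ev (binomial_rest t A) - two.x ^ (t + (e - t)) * G"
    unfolding W_def power_add by (simp only: right_diff_distrib mult.assoc)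
  also have "\<dots> = h one.s - [:fls_const (v ^ m):] * two.s"
    using 1 t unfolding 2 G_def by (simp add: algebra_simps)
  finally have xW: "two.x ^ t * W = h one.s - smult (fls_const (v ^ m)) two.s" by simp
  have "degree (two.x ^ t * W) = degree W"
    by (simp add: const_power)
  moreover have "degree (h one.s - smult (fls_const (v ^ m)) two.s) \<le> 1"
    by (rule degree_diff_le) (simp_all add: hs)
  ultimately have "degree W < d" using xW two.d_ge_2 by simp
  then obtain Q where "W = map_poly laurent Q" by (rule two.B_small_degree[OF W])
  then show ?thesis using xW W_def G by metis
qed

text \<open>
Modulo \<open>X\<close> and \<open>Z\<close>, the identity of the preceding lemma becomes a divisibility by \<open>P\<^sub>2(0, Y\<^sup>m)\<close> in
\<open>k[Y]\<close>. Its part with exponents congruent to \<open>m - 1\<close> modulo \<open>m\<close> is \<open>m v\<^sup>m\<^sup>-\<^sup>1 Y\<^sup>m\<^sup>-\<^sup>1 A(0, Y\<^sup>m)\<close>: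
the polynomial in \<open>s\<close> contributes only multiples of \<open>m\<close>, and \<open>m \<ge> 2\<close>. So \<open>P\<^sub>2(0, S)\<close>, of degree
\<open>d\<close>, divides \<open>A(0, S)\<close>, of smaller degree.
\<close>

lemma x_dvd_remainder:
  assumes hy: "h one.y = smult (fls_const v) two.y + two.x ^ t * map_poly laurent A" and t: "t < e"
    and deg: "degree A < d"
  shows "\<exists>A'. A = smult [:0, 1:] A'"
proof -
  obtain Q G where Q: "G \<in> two.B" "map_poly laurent Q = two.ev (binomial_rest t A) - two.x ^ (e - t) * G"
    using h_s_congruence[OF hy] t by auto
  obtain G' where G': "G = two.ev G'" using Q(1) by (auto simp: two.B_def)
  have "two.ev (subst_S Q two.varS - binomial_rest t A + var_X ^ (e - t) * G') = 0"
    using Q(2) unfolding two.ev.hom_add two.ev.hom_diff two.ev.hom_mult two.ev.hom_power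
      two.ev_var_X two.ev_subst_S two.ev_varS poly_map_const G' by simp
  then have "two.rel dvd subst_S Q two.varS - binomial_rest t A + var_X ^ (e - t) * G'"
    by (simp only: two.ev_eq_0_iff)
  then obtain H where "subst_S Q two.varS - binomial_rest t A + var_X ^ (e - t) * G' = two.rel * H" by (rule dvdE)
  then have "red two.rel dvd red (subst_S Q two.varS - binomial_rest t A + var_X ^ (e - t) * G')"
    by (simp add: red.hom_mult)
  then have dv: "pcompose two.P0 (Polynomial.monom 1 m) dvd red (subst_S Q two.varS) - red (binomial_rest t A)"
    using t by (simp add: red.hom_add red.hom_diff red.hom_mult red.hom_power red_vars two.red_rel zero_power)
  let ?A = "map_poly (\<lambda>p. poly p 0) A" and ?Q = "map_poly (\<lambda>p. poly p 0) Q"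
  \<comment> \<open>The factor \<open>0 ^ 0 = 1\<close> keeps all terms if \<open>t = 0\<close>, and only \<open>r = m - 1\<close> if \<open>t > 0\<close>.\<close>
  define c where "c r = of_nat (m choose r) * v ^ r * 0 ^ (t * (m - r - 1))" for r
  define E where "E r = (if r = 0 then ?Q else 0) - smult (c r) (?A ^ (m - r))" for r
  have "red (of_nat k) = of_nat k" for k
    by (induction k) (simp_all add: red.hom_zero red.hom_one red.hom_add)
  then have red_nat: "red (of_nat k) = [:of_nat k:]" for k by (simp add: of_nat_poly)
  have pc_power: "pcompose p q ^ k = pcompose (p ^ k) q" for p q :: "'a poly" and k
    by (induction k) (simp_all add: pcompose_mult pcompose_1)
  have collect: "[:a:] * [:a':] * p * 0 ^ k * pcompose q w = p * pcompose (smult (a * a' * 0 ^ k) q) w"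
    for a a' :: 'a and p q w :: "'a poly" and k
    by (cases k) (simp_all add: pcompose_smult mult.commute)
  have red_rest: "red (binomial_rest t A) = (\<Sum>r<m. Polynomial.monom 1 r * pcompose (smult (c r) (?A ^ (m - r))) (Polynomial.monom 1 m))"
    unfolding binomial_rest_def red.hom_sum
  proof (rule sum.cong)
    fix r
    have "red (of_nat (m choose r) * const3 (v ^ r) * var_Y ^ r
          * var_X ^ (t * (m - r - 1)) * subst_S A two.varS ^ (m - r))
        = [:of_nat (m choose r):] * [:v ^ r:] * Polynomial.monom 1 r * 0 ^ (t * (m - r - 1))
          * pcompose (?A ^ (m - r)) (Polynomial.monom 1 m)"
      by (simp only: red.hom_mult red.hom_power red_nat red_vars red_subst_S two.red_varS
          pc_power monom_power power_one mult_1)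
    also have "\<dots> = Polynomial.monom 1 r * pcompose (smult (c r) (?A ^ (m - r))) (Polynomial.monom 1 m)"
      unfolding c_def by (rule collect)
    finally show "red (of_nat (m choose r) * const3 (v ^ r) * var_Y ^ r
          * var_X ^ (t * (m - r - 1)) * subst_S A two.varS ^ (m - r)) = \<dots>" .
  qed simp
  have "(\<Sum>r<m. Polynomial.monom 1 r * pcompose (if r = 0 then ?Q else 0) (Polynomial.monom 1 m))
      = (\<Sum>r<m. if r = 0 then pcompose ?Q (Polynomial.monom 1 m) else 0)"
    by (rule sum.cong) (simp_all add: monom_0 one_pCons[symmetric])
  also have "\<dots> = red (subst_S Q two.varS)"
    using one.m_ge_2 by (simp add: red_subst_S two.red_varS)
  finally have sumE: "red (subst_S Q two.varS) - red (binomial_rest t A)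
      = (\<Sum>r<m. Polynomial.monom 1 r * pcompose (E r) (Polynomial.monom 1 m))"
    unfolding red_rest E_def pcompose_diff right_diff_distrib sum_subtractf by simp
  have "two.P0 \<noteq> 0" using two.degree_P0 two.d_ge_2 by force
  then have "two.P0 dvd E (m - 1)"
    using one.m_ge_2 dv unfolding sumE by (intro pcompose_monom_dvd_sum[where m = m and E = E]) simp_all
  moreover have "m choose (m - 1) = m"
    using binomial_symmetric[of 1 m] one.m_ge_2 by (simp only: choose_one)
  then have "E (m - 1) = smult (- (of_nat m * v ^ (m - 1))) ?A"
    using one.m_ge_2 by (simp add: E_def c_def)
  ultimately have "two.P0 dvd ?A"
    using v_nz one.m_ge_2 by (simp add: dvd_smult_iff)
  moreover have "degree ?A < degree two.P0"
    using deg degree_le[of "degree A" ?A] by (simp add: two.degree_P0 coeff_map_poly coeff_eq_0)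
  ultimately have A0: "?A = 0" using dvd_imp_degree_le[of two.P0 ?A] by linarith
  have "[:0, 1:] dvd coeff A j" for j
  proof -
    have "poly (coeff A j) 0 = coeff ?A j" by (simp add: coeff_map_poly)
    then show ?thesis using A0 by (simp add: poly_eq_0_iff_dvd)
  qed
  then have "[:[:0, 1:]:] dvd A" by (simp add: const_poly_dvd_iff)
  then show ?thesis by (auto elim!: dvdE)
qed

lemma h_y_x_power:
  assumes "t \<le> e"
  shows "\<exists>A. degree A < d \<and> h one.y = smult (fls_const v) two.y + two.x ^ t * map_poly laurent A"
  using assms
proof (induction t)
  case 0
  then show ?case using h_y_decomp by simp
next
  case (Suc t)
  then obtain A where A: "degree A < d"
    "h one.y = smult (fls_const v) two.y + two.x ^ t * map_poly laurent A" by auto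
  obtain A' where A': "A = smult [:0, 1:] A'"
    using x_dvd_remainder[OF A(2) _ A(1)] Suc.prems by auto
  have "map_poly laurent A = two.x * map_poly laurent A'"
    by (simp add: A' laurent.map_poly_hom_smult laurent_X)
  then have "h one.y = smult (fls_const v) two.y + two.x ^ Suc t * map_poly laurent A'"
    using A(2) by (simp only: power_Suc2 mult.assoc)
  moreover have "degree A' < d" using A(1) by (simp add: A')
  ultimately show ?case by blast
qed

text \<open>
At \<open>t = e\<close> the congruence says that \<open>x\<^sup>e\<close> divides \<open>h s - v\<^sup>m s = b + (u - v\<^sup>m) s\<close>.
\<close>

lemma v_power: "v ^ m = u"
proof -
  obtain A where A: "h one.y = smult (fls_const v) two.y + two.x ^ e * map_poly laurent A"
    using h_y_x_power[of e] by blast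
  obtain Q where Q: "h one.s - smult (fls_const (v ^ m)) two.s = two.x ^ e * map_poly laurent Q"
    using h_s_congruence[OF A] by blast
  have "coeff (h one.s - smult (fls_const (v ^ m)) two.s) 1 = fls_const u - fls_const (v ^ m)"
    by (simp add: hs)
  also have "\<dots> = laurent [:u - v ^ m:]" by (simp add: laurent_const fls_minus_const)
  finally have "laurent [:u - v ^ m:] = coeff (two.x ^ e * map_poly laurent Q) 1"
    unfolding Q by (rule sym)
  also have "\<dots> = laurent ([:0, 1:] ^ e * coeff Q 1)"
    by (simp add: const_power coeff_map_poly laurent.hom_zero laurent.hom_mult laurent.hom_power laurent_X)
  finally have "[:u - v ^ m:] = [:0, 1:] ^ e * coeff Q 1" by (simp only: laurent_eq_iff)
  then have "poly [:u - v ^ m:] 0 = poly ([:0, 1:] ^ e * coeff Q 1) 0" by (rule arg_cong)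
  then show ?thesis using one.e_pos by (simp add: zero_power)
qed

text \<open>
With \<open>x\<^sup>e\<close> dividing the remainder, \<open>(h x)\<^sup>n h y = P\<^sub>1(h x, h s)\<close> reads
\<open>P\<^sub>1(l x, u s + b) = u\<^sup>d P\<^sub>2(x, s) + l\<^sup>n x\<^sup>n\<^sup>+\<^sup>e A(x, s)\<close>. The coefficient of \<open>s\<^sup>d\<^sup>-\<^sup>1\<close> shows that
\<open>x\<^sup>n\<^sup>+\<^sup>e\<close> divides \<open>b\<close>; then \<open>b\<close> can be dropped modulo \<open>x\<^sup>n\<^sup>+\<^sup>e\<close>.
\<close>

lemma coefficients_cong:
  assumes i: "i \<in> {2..d}"
  shows "[:0, 1:] ^ (n + e) dvd pcompose (f (d - i)) [:0, l:] - smult (u ^ i) (g (d - i))"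
proof -
  define N where "N = ([:0, 1:] :: 'a poly) ^ (n + e)"
  obtain A where A: "h one.y = smult (fls_const v) two.y + two.x ^ e * map_poly laurent A"
    using h_y_x_power[of e] by blast
  define P' where "P' = map_poly (\<lambda>p. pcompose p [:0, l:]) one.P"
  define S where "S = [:b, [:u:]:]"
  have c: "coeff P' j = (if j = d then 1 else if j \<le> d - 2 then pcompose (f j) [:0, l:] else 0)" for j
    by (simp add: P'_def coeff_map_poly coeff_monic_poly one.d_ge_2 pcompose_1)
  have S: "h one.s = map_poly laurent S"
    by (simp add: S_def hs map_poly_pCons laurent.hom_zero laurent_const)
  have lN: "laurent ([:l ^ n:] * N) = fls_const (l ^ n) * fls_X ^ (n + e)"
    by (simp only: N_def laurent.hom_mult laurent.hom_power laurent_const laurent_X)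
  have vl: "v * l ^ n = u ^ d" by (simp add: v_def l)
  have "map_poly laurent (pcompose P' S) = h one.Ps"
    unfolding one.Ps_def h_map_laurent[OF hx] laurent.map_poly_hom_pcompose S P'_def ..
  also have "\<dots> = h one.x ^ n * h one.y"
    by (simp only: one.x_power_y[symmetric] h_mult h_power one.B_power one.B_x one.B_y)
  also have "h one.x ^ n = smult (fls_const (l ^ n)) (two.x ^ n)"
    by (simp add: h_x const_power power_mult_distrib fls_const_power)
  also have "smult (fls_const (l ^ n)) (two.x ^ n) * h one.y =
      smult (fls_const (v * l ^ n)) (two.x ^ n * two.y) 
      + smult (fls_const (l ^ n)) (two.x ^ (n + e) * map_poly laurent A)"
    unfolding A power_add
    by (simp only: distrib_left mult_smult_left mult_smult_right smult_add_right smult_smult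
        fls_const_mult_const[symmetric] mult.assoc mult.commute[of "fls_const v"])
  also have "\<dots> = map_poly laurent (smult [:u ^ d:] two.P + smult ([:l ^ n:] * N) A)"
    unfolding two.x_power_y vl two.Ps_def laurent.map_poly_hom_add laurent.map_poly_hom_smult lN laurent_const
    by (simp add: const_power)
  finally have main: "pcompose P' S = smult [:u ^ d:] two.P + smult ([:l ^ n:] * N) A"
    by (simp only: map_laurent_eq_iff)
  have N_b: "N dvd b"
  proof -
    \<comment> \<open>Without a term of degree \<open>d - 1\<close>, the coefficient of \<open>s\<^sup>d\<^sup>-\<^sup>1\<close> comes from \<open>(b + u s)\<^sup>d\<close> alone;
      characteristic 0 makes its factor \<open>d u\<^sup>d\<^sup>-\<^sup>1\<close> a unit.\<close>
    define L where "L = P' - Polynomial.monom 1 d"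
    have "degree L \<le> d - 2"
      by (rule degree_le) (auto simp: L_def c)
    then have "degree (pcompose L S) \<le> d - 2"
      using degree_pcompose_le[of L S] u by (simp add: S_def)
    then have "coeff (pcompose L S) (d - 1) = 0"
      using one.d_ge_2 by (intro coeff_eq_0) linarith
    moreover have "pcompose P' S = pcompose L S + S ^ d"
      by (simp add: L_def pcompose_diff pcompose_monom_one)
    moreover have "d choose (d - 1) = d"
      using binomial_symmetric[of 1 d] one.d_ge_2 by (simp only: choose_one)
    then have "coeff (S ^ d) (d - 1) = of_nat d * [:u:] ^ (d - 1) * b"
      using one.d_ge_2 coeff_linear_poly_power[of "d - 1" d b "[:u:]"] by (simp add: S_def)
    ultimately have "of_nat d * [:u:] ^ (d - 1) * b = coeff (pcompose P' S) (d - 1)"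
      by simp
    also have "\<dots> = N * ([:l ^ n:] * coeff A (d - 1))"
      unfolding main using one.d_ge_2
      by (simp add: coeff_monic_poly mult.commute) (auto dest: leD)
    finally have "N dvd of_nat d * [:u:] ^ (d - 1) * b" by (simp only: dvd_triv_left)
    moreover have "of_nat d * [:u:] ^ (d - 1) * b = smult (of_nat d * u ^ (d - 1)) b"
      by (simp add: of_nat_poly const_power mult.commute)
    moreover have "of_nat d * u ^ (d - 1) \<noteq> 0" using u one.d_ge_2 by simp
    ultimately show ?thesis by (metis dvd_smult_iff)
  qed
  define j where "j = d - i"
  have j: "j \<le> d - 2" "j < d" "j + i = d" using i by (auto simp: j_def)
  have "[:N:] dvd S - [:0, [:u:]:]"
    using N_b by (simp add: S_def const_poly_dvd_iff coeff_pCons split: nat.splits)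
  then have "[:N:] dvd pcompose P' S - pcompose P' [:0, [:u:]:]"
    using pcompose_dvd_diff dvd_trans by blast
  then have "N dvd coeff (pcompose P' S - pcompose P' [:0, [:u:]:]) j"
    by (simp only: const_poly_dvd_iff)
  then have "N dvd [:u ^ d:] * g j + [:l ^ n:] * N * coeff A j - [:u:] ^ j * pcompose (f j) [:0, l:]"
    unfolding main using j one.d_ge_2 by (simp add: coeff_pcompose_linear c coeff_monic_poly)
  then have "N dvd ([:u ^ d:] * g j + [:l ^ n:] * N * coeff A j - [:u:] ^ j * pcompose (f j) [:0, l:])
      - N * ([:l ^ n:] * coeff A j)"
    by (rule dvd_diff[OF _ dvd_triv_left])
  also have "([:u ^ d:] * g j + [:l ^ n:] * N * coeff A j - [:u:] ^ j * pcompose (f j) [:0, l:])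
      - N * ([:l ^ n:] * coeff A j) = smult (- (u ^ j)) (pcompose (f j) [:0, l:] - smult (u ^ i) (g j))"
    unfolding j(3)[symmetric] by (simp add: const_power smult_diff_right power_add)
  finally show ?thesis
    using u by (simp only: dvd_smult_iff N_def j_def) (simp add: dvd_smult_iff)
qed

end

section \<open>Isomorphisms from rescaling the coordinates\<close>

text \<open>
The substitution \<open>x \<mapsto> l x\<close>, \<open>s \<mapsto> u s\<close> of \<open>k((x))[s]\<close>.
\<close>

definition rescale :: "'a::field_char_0 \<Rightarrow> 'a \<Rightarrow> 'a fls poly \<Rightarrow> 'a fls poly"
  where "rescale l u F =
    pcompose (map_poly (\<lambda>c. fls_compose_fps c (fps_const l * fps_X)) F) [:0, fls_const u:]"

lemma cring_hom_pcompose: "cring_hom (\<lambda>p. pcompose p q)"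
  by unfold_locales (simp_all add: pcompose_add pcompose_mult pcompose_1)

lemma cring_hom_fls_compose:
  assumes "l \<noteq> 0"
  shows "cring_hom (\<lambda>c. fls_compose_fps c (fps_const (l :: 'a::field) * fps_X))"
proof -
  have "fps_const l * fps_X \<noteq> 0" using assms by simp
  then show ?thesis
    by unfold_locales (simp_all add: fls_compose_fps_add fls_compose_fps_mult)
qed

lemma cring_hom_rescale: "l \<noteq> 0 \<Longrightarrow> cring_hom (rescale l u)"
  unfolding rescale_def
  by (rule cring_hom_comp[OF cring_hom.cring_hom_map_poly[OF cring_hom_fls_compose] cring_hom_pcompose])

lemma coeff_rescale:
  assumes "l \<noteq> 0"
  shows "fls_nth (coeff (rescale l u F) j) i = u ^ j * (l powi i * fls_nth (coeff F j) i)"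
  using cring_hom.hom_zero[OF cring_hom_fls_compose[OF assms]] assms
  by (simp add: rescale_def coeff_pcompose_linear coeff_map_poly fls_nth_fls_compose_fps_linear
      fls_const_power[symmetric])

lemma rescale_inverse:
  assumes "l \<noteq> 0" "u \<noteq> 0"
  shows "rescale (inverse l) (inverse u) (rescale l u F) = F"
proof -
  have "inverse u ^ j * (inverse l powi i * (u ^ j * (l powi i * c))) = c" for i j c
  proof -
    have "inverse u ^ j * (inverse l powi i * (u ^ j * (l powi i * c)))
        = (u ^ j * inverse u ^ j) * (l powi i * inverse l powi i) * c"
      by (simp only: ac_simps)
    also have "u ^ j * inverse u ^ j = 1"
      using assms by (simp add: power_inverse)
    also have "l powi i * inverse l powi i = 1"
      using assms by (simp add: power_int_inverse)
    finally show ?thesis by simp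
  qed
  then show ?thesis
    using assms by (intro poly_eqI fls_eqI) (simp add: coeff_rescale)
qed

lemma rescale_map_laurent:
  assumes "l \<noteq> 0"
  shows "rescale l u (map_poly laurent Q)
    = map_poly laurent (pcompose (map_poly (\<lambda>p. pcompose p [:0, l:]) Q) [:0, [:u:]:])"
proof (intro poly_eqI fls_eqI)
  fix j i
  have "[:u:] ^ j = [:u ^ j:]" by (induction j) (simp_all add: one_pCons)
  then show "fls_nth (coeff (rescale l u (map_poly laurent Q)) j) i = fls_nth (coeff (map_poly laurent
    (pcompose (map_poly (\<lambda>p. pcompose p [:0, l:]) Q) [:0, [:u:]:])) j) i"
    using assms
    by (cases "i < 0") (auto simp: coeff_rescale coeff_map_poly laurent.hom_zero coeff_pcompose_linear laurent_nth
        power_int_def)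
qed

locale danielewski_cong =
  one: danielewski n e m d f + two: danielewski n e m d g
  for n e m d :: nat and f g :: "nat \<Rightarrow> 'a::field_char_0 poly" +
  fixes l u :: 'a
  assumes l: "l \<noteq> 0" and u: "u \<noteq> 0" and lu: "(u ^ d / l ^ n) ^ m = u"
    and coeffs: "i \<in> {2..d} \<Longrightarrow>
      [:0, 1:] ^ (n + e) dvd pcompose (f (d - i)) [:0, l:] - smult (u ^ i) (g (d - i))"
begin

sublocale rs: cring_hom "rescale l u"
  by (rule cring_hom_rescale[OF l])

lemma rescale_laurent: "rescale l u [:laurent p:] = [:laurent (pcompose p [:0, l:]):]"
  using rescale_map_laurent[OF l, of u "[:p:]"] by (simp add: map_poly_pCons laurent.hom_zero)

lemma rescale_const: "rescale l u [:fls_const c:] = [:fls_const c:]"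
  using rescale_laurent[of "[:c:]"] by (simp add: laurent_const)

lemma rescale_x: "rescale l u one.x = [:fls_const l:] * two.x"
  using rescale_laurent[of "[:0, 1:]"] by (simp add: laurent_X laurent_linear pcompose_pCons)

lemma rescale_s: "rescale l u one.s = [:fls_const u:] * two.s"
  using rescale_map_laurent[OF l, of u "[:0, 1:]"]
  by (simp add: map_poly_pCons laurent.hom_zero laurent.hom_one pcompose_pCons laurent_const pcompose_1)

lemma rescale_cancel:
  assumes "rescale l u (one.x ^ k * F) = two.x ^ k * G" "G \<in> two.B"
  shows "rescale l u F = [:fls_const (inverse l ^ k):] * G" "rescale l u F \<in> two.B"
proof -
  have "two.x ^ k * ([:fls_const l:] ^ k * rescale l u F) = two.x ^ k * G"
    using assms(1) by (simp only: rs.hom_mult rs.hom_power rescale_x power_mult_distrib ac_simps)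
  moreover have "two.x ^ k \<noteq> 0" by simp
  ultimately have "[:fls_const l:] ^ k * rescale l u F = G" using mult_left_cancel by blast
  then have "[:fls_const (inverse l ^ k):] * G = [:fls_const (inverse l ^ k * l ^ k):] * rescale l u F"
    by (auto simp: const_power fls_const_power[symmetric])
  also have "inverse l ^ k * l ^ k = 1" using l by (simp add: power_inverse)
  finally show "rescale l u F = [:fls_const (inverse l ^ k):] * G" by simp
  then show "rescale l u F \<in> two.B" using assms(2) two.B_mult two.B_const by metis
qed

text \<open>
The congruences compare the coefficients of \<open>P\<^sub>1(l x, u s)\<close> and \<open>u\<^sup>d P\<^sub>2(x, s)\<close>.
\<close>

lemma rescale_Ps:
  "\<exists>V. rescale l u one.Ps = [:fls_const (u ^ d):] * two.Ps + two.x ^ (n + e) * map_poly laurent V"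
proof -
  define N where "N = ([:0, 1:] :: 'a poly) ^ (n + e)"
  define Q where "Q = pcompose (map_poly (\<lambda>p. pcompose p [:0, l:]) one.P) [:0, [:u:]:]"
  have "N dvd coeff (Q - smult [:u ^ d:] two.P) j" for j
  proof -
    have Q: "coeff Q j = smult (u ^ j) (pcompose (coeff one.P j) [:0, l:])" for j
      by (simp add: Q_def coeff_pcompose_linear coeff_map_poly const_power)
    consider "j = d" | "j \<le> d - 2" "j \<noteq> d" | "j > d - 2" "j \<noteq> d" by linarith
    then show ?thesis
    proof cases
      case 1
      then show ?thesis by (simp add: Q coeff_monic_poly one.d_ge_2 pcompose_1)
    next
      case 2
      define i where "i = d - j"
      have i: "i \<in> {2..d}" "d - i = j" "u ^ d = u ^ j * u ^ i"
        using 2 one.d_ge_2 by (auto simp: i_def power_add[symmetric])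
      have "coeff (Q - smult [:u ^ d:] two.P) j = smult (u ^ j) (pcompose (f j) [:0, l:] - smult (u ^ i) (g j))"
        using 2 by (simp add: Q coeff_monic_poly one.d_ge_2 i(3) smult_diff_right)
      then show ?thesis using coeffs[OF i(1)] by (simp add: i(2) N_def dvd_smult)
    next
      case 3
      then show ?thesis by (simp add: Q coeff_monic_poly one.d_ge_2)
    qed
  qed
  then have "[:N:] dvd Q - smult [:u ^ d:] two.P" unfolding const_poly_dvd_iff by blast
  then obtain V where "Q - smult [:u ^ d:] two.P = [:N:] * V" by (rule dvdE)
  then have "Q = [:[:u ^ d:]:] * two.P + [:N:] * V" by (simp add: algebra_simps)
  then have "map_poly laurent Q = [:laurent [:u ^ d:]:] * two.Ps + [:laurent N:] * map_poly laurent V"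
    by (simp only: laurent.map_poly_hom_add laurent.map_poly_hom_mult map_poly_laurent_const two.Ps_def)
  moreover have "[:laurent N:] = two.x ^ (n + e)"
    by (simp only: N_def laurent.hom_power laurent_X const_power)
  moreover have "rescale l u one.Ps = map_poly laurent Q"
    by (simp only: one.Ps_def rescale_map_laurent[OF l] Q_def)
  ultimately show ?thesis by (metis laurent_const)
qed

lemma rescale_y:
  "\<exists>W\<in>two.B. rescale l u one.y = [:fls_const (u ^ d / l ^ n):] * two.y + two.x ^ e * W"
proof -
  obtain V where V: "rescale l u one.Ps
      = [:fls_const (u ^ d):] * two.Ps + two.x ^ (n + e) * map_poly laurent V"
    using rescale_Ps by blast
  have "rescale l u (one.x ^ n * one.y)
      = two.x ^ n * ([:fls_const (u ^ d):] * two.y + two.x ^ e * map_poly laurent V)"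
    unfolding one.x_power_y V two.x_power_y[symmetric] power_add by (simp only: distrib_left ac_simps)
  then have "rescale l u one.y = [:fls_const (inverse l ^ n):] *
      ([:fls_const (u ^ d):] * two.y + two.x ^ e * map_poly laurent V)"
    by (rule rescale_cancel)
      (intro two.B_add two.B_mult two.B_power two.B_const two.B_x two.B_y two.B_map_laurent)
  also have "\<dots> = [:fls_const (inverse l ^ n):] * [:fls_const (u ^ d):] * two.y
      + two.x ^ e * ([:fls_const (inverse l ^ n):] * map_poly laurent V)"
    by (simp only: distrib_left ac_simps)
  also have "[:fls_const (inverse l ^ n):] * [:fls_const (u ^ d):] = [:fls_const (u ^ d / l ^ n):]"
    by (simp add: divide_inverse power_inverse mult.commute)
  finally show ?thesis
    by (metis two.B_mult two.B_const two.B_map_laurent)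
qed

text \<open>
Only \<open>z\<close> is not immediate. The image of \<open>y\<^sup>m - s\<close> is \<open>(v y + x\<^sup>e W)\<^sup>m - u s\<close> with \<open>v\<^sup>m = u\<close>, that is
\<open>u (y\<^sup>m - s)\<close> up to a multiple of \<open>x\<^sup>e\<close>; hence it is divisible by \<open>x\<^sup>e\<close>.
\<close>

lemma rescale_B: "F \<in> one.B \<Longrightarrow> rescale l u F \<in> two.B"
proof (induction rule: one.B_induct)
  case (const p)
  show ?case by (simp only: rescale_laurent two.B_laurent)
next
  case (add F G)
  then show ?case by (simp only: rs.hom_add two.B_add)
next
  case (mult F G)
  then show ?case by (simp only: rs.hom_mult two.B_mult)
next
  case Y
  then show ?case
    using rescale_y two.B_add two.B_mult two.B_power two.B_const two.B_x two.B_y by metis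
next
  case Z
  define v where "v = u ^ d / l ^ n"
  obtain W where W: "W \<in> two.B" "rescale l u one.y = [:fls_const v:] * two.y + two.x ^ e * W"
    using rescale_y unfolding v_def by blast
  define T where "T = (\<Sum>i<m. ([:fls_const v:] * two.y) ^ (m - Suc i) * rescale l u one.y ^ i)"
  have T: "T \<in> two.B"
    unfolding T_def W(2)
    by (intro two.B_sum two.B_mult two.B_power two.B_add two.B_const two.B_y two.B_x W)
  have "rescale l u one.y ^ m - ([:fls_const v:] * two.y) ^ m
      = (rescale l u one.y - [:fls_const v:] * two.y) * T"
    unfolding T_def by (rule power_diff_sumr2)
  also have "rescale l u one.y - [:fls_const v:] * two.y = two.x ^ e * W"
    by (simp only: W(2) add_diff_cancel_left')
  finally have "rescale l u one.y ^ m = ([:fls_const v:] * two.y) ^ m + two.x ^ e * W * T"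
    by (simp only: diff_eq_eq add.commute)
  also have "([:fls_const v:] * two.y) ^ m = [:fls_const u:] * two.y ^ m"
    using lu by (simp only: power_mult_distrib const_power fls_const_power[symmetric] v_def)
  finally have "rescale l u (one.y ^ m - one.s)
      = [:fls_const u:] * (two.y ^ m - two.s) + two.x ^ e * (W * T)"
    unfolding rs.hom_diff rs.hom_power rescale_s by (simp add: algebra_simps del: mult_pCons_left mult_pCons_right)
  then have "rescale l u (one.x ^ e * one.z) = two.x ^ e * ([:fls_const u:] * two.z + W * T)"
    unfolding one.x_power_z[symmetric] two.x_power_z[symmetric] by (simp only: distrib_left ac_simps)
  then show ?case
    by (rule rescale_cancel) (intro two.B_add two.B_mult two.B_const two.B_z W T)
qed

text \<open>
Substituting \<open>X / l\<close> for \<open>X\<close> turns the congruences for \<open>(l, u)\<close> into those for the inverse scalars.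
\<close>

lemma flip: "danielewski_cong n e m d g f (inverse l) (inverse u)"
proof unfold_locales
  show "(inverse u ^ d / inverse l ^ n) ^ m = inverse u"
  proof -
    have "inverse u ^ d / inverse l ^ n = inverse (u ^ d / l ^ n)"
      by (simp add: power_inverse field_simps)
    then have "(inverse u ^ d / inverse l ^ n) ^ m = inverse ((u ^ d / l ^ n) ^ m)"
      by (simp only: power_inverse)
    then show ?thesis by (simp only: lu)
  qed
next
  fix i assume i: "i \<in> {2..d}"
  define F where "F = f (d - i)"
  define G where "G = g (d - i)"
  obtain V where V: "pcompose F [:0, l:] - smult (u ^ i) G = [:0, 1:] ^ (n + e) * V"
    using coeffs[OF i] unfolding F_def G_def by (rule dvdE)
  have comp: "pcompose [:0, l:] [:0, inverse l:] = [:0, 1:]"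
    using l by (simp add: pcompose_pCons)
  have pc_power: "pcompose (p ^ k) q = pcompose p q ^ k" for p q :: "'a poly" and k
    by (rule cring_hom.hom_power[OF cring_hom_pcompose])
  have "F - smult (u ^ i) (pcompose G [:0, inverse l:]) = 
      pcompose (pcompose F [:0, l:] - smult (u ^ i) G) [:0, inverse l:]"
    by (simp add: pcompose_diff pcompose_smult pcompose_assoc[symmetric] comp)
  also have "\<dots> = [:0, inverse l:] ^ (n + e) * pcompose V [:0, inverse l:]"
    unfolding V by (simp add: pcompose_mult pc_power pcompose_pCons)
  also have "[:0, inverse l:] = [:inverse l:] * [:0, 1:]" by simp
  finally have "[:0, 1:] ^ (n + e) dvd F - smult (u ^ i) (pcompose G [:0, inverse l:])"
    by (simp only: power_mult_distrib) (simp add: mult.assoc mult.left_commute)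
  then have "[:0, 1:] ^ (n + e) dvd smult (- (inverse u ^ i)) (F - smult (u ^ i) (pcompose G [:0, inverse l:]))"
    by (rule dvd_smult)
  also have "\<dots> = pcompose G [:0, inverse l:] - smult (inverse u ^ i) F"
    using u by (simp add: smult_diff_right power_inverse)
  finally show "[:0, 1:] ^ (n + e) dvd pcompose (g (d - i)) [:0, inverse l:] - smult (inverse u ^ i) (f (d - i))"
    by (simp only: F_def G_def)
qed (use l u in simp_all)

end

section \<open>From quotient rings to subrings of \<open>k((x))[s]\<close>\<close>

abbreviation fls_ring :: "'a::field_char_0 fls poly set \<Rightarrow> 'a fls poly ring"
  where "fls_ring B \<equiv> ring_of_type_algebra \<lparr>carrier := B\<rparr>"

lemma algebra_isomorphic_sym:
  assumes "ring A" "\<And>c. a c \<in> carrier A" "algebra_isomorphic A a B b"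
  shows "algebra_isomorphic B b A a"
proof -
  obtain h where h: "h \<in> ring_iso A B" "\<And>c. h (a c) = b c"
    using assms(3) by (auto simp: algebra_isomorphic_def)
  have "inj_on h (carrier A)" using h(1) by (auto simp: ring_iso_def bij_betw_def)
  then have "inv_into (carrier A) h (b c) = a c" for c
    using h(2) assms(2) by (metis inv_into_f_f)
  then show ?thesis
    using ring_iso_set_sym[OF assms(1) h(1)] by (auto simp: algebra_isomorphic_def)
qed

lemma algebra_isomorphic_trans:
  assumes "algebra_isomorphic A a B b" "algebra_isomorphic B b C c"
  shows "algebra_isomorphic A a C c"
proof -
  obtain h k where "h \<in> ring_iso A B" "\<And>r. h (a r) = b r" "k \<in> ring_iso B C" "\<And>r. k (b r) = c r"
    using assms by (auto simp: algebra_isomorphic_def)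
  then show ?thesis
    unfolding algebra_isomorphic_def by (intro bexI[OF _ ring_iso_set_trans]) auto
qed

context danielewski
begin

lemma ring_hom_ev: "ring_hom_ring ring_kXYZ ring_of_type_algebra ev"
  by (intro ring_hom_ringI ring_from_type_algebra)
    (auto simp: ring_of_type_algebra_def ev.hom_add ev.hom_mult ev.hom_one)

lemma kernel_ev: "a_kernel ring_kXYZ ring_of_type_algebra ev = R_ideal n e P m"
proof -
  have "R_ideal n e P m = PIdl\<^bsub>ring_kXYZ\<^esub> rel"
    by (simp only: R_ideal_def rel_def varS_def)
  then have "F \<in> a_kernel ring_kXYZ ring_of_type_algebra ev \<longleftrightarrow> F \<in> R_ideal n e P m" for F
    unfolding a_kernel_def' cgenideal_def
    by (auto simp: ring_of_type_algebra_def ev_eq_0_iff dvd_def mult.commute)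
  then show ?thesis by blast
qed

lemma ring_R: "ring (R_ring n e P m)"
proof -
  interpret ring_hom_ring ring_kXYZ ring_of_type_algebra ev by (rule ring_hom_ev)
  show ?thesis unfolding R_ring_def kernel_ev[symmetric]
    by (rule ideal.quotient_is_ring[OF kernel_is_ideal])
qed

lemma R_const_carrier: "R_const n e P m c \<in> carrier (R_ring n e P m)"
  by (auto simp: R_const_def R_ring_def FactRing_def A_RCOSETS_def' ring_of_type_algebra_def)

text \<open>
The first isomorphism theorem for the evaluation, whose kernel is the defining ideal.
\<close>

lemma R_iso_B:
  "algebra_isomorphic (R_ring n e P m) (R_const n e P m) (fls_ring B) (\<lambda>c. [:fls_const c:])"
proof -
  interpret ring_hom_ring ring_kXYZ ring_of_type_algebra ev by (rule ring_hom_ev)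
  have "carrier ring_kXYZ = (UNIV :: 'a poly poly poly set)" by (simp add: ring_of_type_algebra_def)
  then show ?thesis
    unfolding algebra_isomorphic_def R_ring_def R_const_def kernel_ev[symmetric] B_def
    using FactRing_iso_set_aux the_elem_simp[of "const3 _"] ev_const3
    by (intro bexI[of _ "\<lambda>K. the_elem (ev ` K)"]) auto
qed

end

section \<open>The isomorphism criterion\<close>

lemma algebra_isomorphic_B:
  assumes "danielewski n1 e1 m d1" "danielewski n2 e2 m d2"
  shows "algebra_isomorphic (R_ring n1 e1 (monic_poly d1 f) m) (R_const n1 e1 (monic_poly d1 f) m)
      (R_ring n2 e2 (monic_poly d2 g) m) (R_const n2 e2 (monic_poly d2 g) m)
    \<longleftrightarrow> algebra_isomorphic (fls_ring (danielewski.B n1 e1 m d1 f)) (\<lambda>c. [:fls_const c:])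
      (fls_ring (danielewski.B n2 e2 m d2 g)) (\<lambda>c. [:fls_const c:])"
proof -
  note iso1 = danielewski.R_iso_B[OF assms(1), of f]
  note iso2 = danielewski.R_iso_B[OF assms(2), of g]
  note osi1 = algebra_isomorphic_sym[OF danielewski.ring_R[OF assms(1)]
      danielewski.R_const_carrier[OF assms(1)] iso1]
  note osi2 = algebra_isomorphic_sym[OF danielewski.ring_R[OF assms(2)]
      danielewski.R_const_carrier[OF assms(2)] iso2]
  show ?thesis
    using algebra_isomorphic_trans[OF osi1 algebra_isomorphic_trans[OF _ iso2]]
      algebra_isomorphic_trans[OF iso1 algebra_isomorphic_trans[OF _ osi2]] by blast
qed

lemma algebra_isomorphic_fls_ring:
  "algebra_isomorphic (fls_ring B1) (\<lambda>c. [:fls_const c:]) (fls_ring B2) (\<lambda>c. [:fls_const c:])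
    \<longleftrightarrow> (\<exists>h. bij_betw h B1 B2 \<and> (\<forall>F\<in>B1. \<forall>G\<in>B1. h (F + G) = h F + h G \<and> h (F * G) = h F * h G)
      \<and> h 1 = 1 \<and> (\<forall>c. h [:fls_const c:] = [:fls_const c:]))"
  unfolding algebra_isomorphic_def ring_iso_def ring_hom_def
  by (auto simp: ring_of_type_algebra_def bij_betw_def)

lemma danielewski_iso_I:
  assumes "danielewski n1 e1 m d1" "danielewski n2 e2 m d2"
    and bij: "bij_betw h (danielewski.B n1 e1 m d1 f) (danielewski.B n2 e2 m d2 g)"
    and hom: "\<forall>F\<in>danielewski.B n1 e1 m d1 f. \<forall>G\<in>danielewski.B n1 e1 m d1 f.
      h (F + G) = h F + h G \<and> h (F * G) = h F * h G"
    and const: "\<forall>c. h [:fls_const c:] = [:fls_const c:]"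
  shows "danielewski_iso n1 e1 m d1 f n2 e2 d2 g h (inv_into (danielewski.B n1 e1 m d1 f) h)"
  using assms(1,2)
proof (rule danielewski_iso.intro, intro danielewski_iso_axioms.intro)
  let ?h' = "inv_into (danielewski.B n1 e1 m d1 f) h"
  have bij': "bij_betw ?h' (danielewski.B n2 e2 m d2 g) (danielewski.B n1 e1 m d1 f)"
    by (rule bij_betw_inv_into[OF bij])
  show "h F \<in> danielewski.B n2 e2 m d2 g" if "F \<in> danielewski.B n1 e1 m d1 f" for F
    using bij that by (rule bij_betw_apply)
  show "?h' F \<in> danielewski.B n1 e1 m d1 f" if "F \<in> danielewski.B n2 e2 m d2 g" for F
    using bij' that by (rule bij_betw_apply)
  show "?h' (h F) = F" if "F \<in> danielewski.B n1 e1 m d1 f" for F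
    using bij that by (rule bij_betw_inv_into_left)
  show "h (?h' F) = F" if "F \<in> danielewski.B n2 e2 m d2 g" for F
    using bij that by (rule bij_betw_inv_into_right)
qed (use hom const in blast)+

lemma isomorphism_imp_cong:
  assumes "danielewski_iso n1 e1 m d1 f n2 e2 d2 g h h'"
  shows "n1 = n2 \<and> e1 = e2 \<and> d1 = d2 \<and>
    (\<exists>l u. l \<noteq> 0 \<and> u \<noteq> 0 \<and> u ^ (d1 * m) / l ^ (n1 * m) = u \<and>
      (\<forall>i\<in>{2..d1}. [pcompose (f (d1 - i)) [:0, l:] = smult (u ^ i) (g (d1 - i))] (mod [:0, 1:] ^ (n1 + e1))))"
proof -
  interpret iso: danielewski_iso n1 e1 m d1 f n2 e2 d2 g h h' by (rule assms)
  note eq = iso.parameters_eq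
  obtain l where l: "l \<noteq> 0" "h iso.one.x = [:laurent [:0, l:]:]" by (rule iso.h_x_scaling)
  obtain b u where u: "u \<noteq> 0" "h iso.one.s = [:laurent b, fls_const u:]" using iso.h_s_linear by blast
  interpret danielewski_iso_eq n1 e1 m d1 f g h h' l u b
  proof (intro danielewski_iso_eq.intro danielewski_iso_eq_axioms.intro)
    show "danielewski_iso n1 e1 m d1 f n1 e1 d1 g h h'" using assms by (simp only: eq)
  qed (use l u in auto)
  have "u ^ (d1 * m) / l ^ (n1 * m) = u"
    using v_power by (simp only: v_def power_divide power_mult)
  then show ?thesis
    using eq l(1) u(1) coefficients_cong by (auto simp only: cong_iff_dvd_diff)
qed

lemma cong_imp_isomorphic:
  assumes "danielewski_cong n e m d f g l u"
  shows "bij_betw (rescale l u) (danielewski.B n e m d f) (danielewski.B n e m d g)"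
proof -
  interpret danielewski_cong n e m d f g l u by (rule assms)
  interpret inv: danielewski_cong n e m d g f "inverse l" "inverse u" by (rule flip)
  show ?thesis
  proof (rule bij_betw_byWitness[where f' = "rescale (inverse l) (inverse u)"])
    show "\<forall>F\<in>one.B. rescale (inverse l) (inverse u) (rescale l u F) = F"
      by (simp add: rescale_inverse l u)
    show "\<forall>F\<in>two.B. rescale l u (rescale (inverse l) (inverse u) F) = F"
      using rescale_inverse[OF inv.l inv.u] by simp
  qed (use rescale_B inv.rescale_B in auto)
qed

theorem proposition4p12:
  fixes f g :: "nat \<Rightarrow> 'a::field_char_0 poly"
    and m n1 n2 e1 e2 d1 d2 :: nat
  assumes "m \<ge> 2"
    and "n1 \<ge> 1" and "n2 \<ge> 1"
    and "e1 \<ge> 1" and "e2 \<ge> 1"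
    and "d1 \<ge> 2" and "d2 \<ge> 2"
  shows "algebra_isomorphic
           (R_ring n1 e1 (monic_poly d1 f) m) (R_const n1 e1 (monic_poly d1 f) m)
           (R_ring n2 e2 (monic_poly d2 g) m) (R_const n2 e2 (monic_poly d2 g) m)
     \<longleftrightarrow> n1 = n2 \<and> e1 = e2 \<and> d1 = d2 \<and>
         (\<exists>l u :: 'a. l \<noteq> 0 \<and> u \<noteq> 0 \<and>
            u ^ (d1 * m) / l ^ (n1 * m) = u \<and>
            (\<forall>i\<in>{2..d1}.
               [pcompose (f (d1 - i)) [:0, l:] = smult (u ^ i) (g (d1 - i))]
                 (mod [:0, 1:] ^ (n1 + e1))))"
    (is "?iso \<longleftrightarrow> ?cong")
proof -
  have dd: "danielewski n1 e1 m d1" "danielewski n2 e2 m d2"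
    using assms by (simp_all add: danielewski_def)
  show ?thesis
  proof
    assume ?iso
    then obtain h where "bij_betw h (danielewski.B n1 e1 m d1 f) (danielewski.B n2 e2 m d2 g)"
      "\<forall>F\<in>danielewski.B n1 e1 m d1 f. \<forall>G\<in>danielewski.B n1 e1 m d1 f.
        h (F + G) = h F + h G \<and> h (F * G) = h F * h G"
      "\<forall>c. h [:fls_const c:] = [:fls_const c:]"
      unfolding algebra_isomorphic_B[OF dd] algebra_isomorphic_fls_ring by blast
    then show ?cong by (rule isomorphism_imp_cong[OF danielewski_iso_I[OF dd]])
  next
    assume ?cong
    then obtain l u where eq: "n2 = n1" "e2 = e1" "d2 = d1"
      and lu: "l \<noteq> 0" "u \<noteq> 0" "u ^ (d1 * m) / l ^ (n1 * m) = u"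
      and "\<forall>i\<in>{2..d1}. [pcompose (f (d1 - i)) [:0, l:] = smult (u ^ i) (g (d1 - i))] (mod [:0, 1:] ^ (n1 + e1))"
      by auto
    then interpret danielewski_cong n1 e1 m d1 f g l u
      using dd(1)
      by (intro danielewski_cong.intro danielewski_cong_axioms.intro)
        (simp_all add: cong_iff_dvd_diff power_divide power_mult)
    have "bij_betw (rescale l u) one.B two.B"
      by (rule cong_imp_isomorphic) unfold_locales
    then show ?iso
      unfolding algebra_isomorphic_B[OF dd] algebra_isomorphic_fls_ring unfolding eq
      by (intro exI[of _ "rescale l u"] conjI ballI allI rs.hom_add rs.hom_mult rs.hom_one rescale_const)
  qed
qed

end
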